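(* For every sentence $\varphi$ of the $\nu$-fragment of the $\mu$-calculus on data words there is an effectively constructed data $\omega$-automaton $\mathcal A_\varphi=(B,\Sigma',C,C_\omega)$ such that $\varphi$ and $\mathcal A_\varphi$ define the same data $\omega$-language. Moreover, the data automaton $(B,\Sigma',C)$ and $\varphi$ define the same data language.
   Context: Fix a finite alphabet $\Sigma$ and an infinite set $\mathcal D$. A data word (resp. data $\omega$-word) is a finite (resp. infinite) sequence $w=(a_1,d_1)(a_2,d_2)\cdots$ over $\Sigma\times\mathcal D$, with positions $1,2,\dots$; $i\sim j$ iff $d_i=d_j$; a class is a maximal set of positions with the same data value. The class successor (class predecessor) of $i$ is the least $j>i$ (greatest $j<i$) with $j\sim i$, if any. $\mu$-calculus: $\varphi::= x\mid A\mid\neg A\mid \mathsf M\varphi\mid\varphi\vee\varphi\mid\varphi\wedge\varphi\mid\mu x.\varphi\mid\nu x.\varphi$, atoms $A$: letters $a\in\Sigma$ and $\mathsf S,\mathsf P,\mathsf{first}^g,\mathsf{last}^g,\mathsf{first}^c,\mathsf{last}^c$; $\mathsf M\in\{\mathtt X^g,\mathtt X^c,\mathtt Y^g,\mathtt Y^c\}$. Semantics as sets of positions: $a$ at $i$ iff $a_i=a$; $\mathsf{first}^g$ only at 1; $\mathsf{last}^g$ only at the last position (if any); $\mathsf{first}^c$/$\mathsf{last}^c$ at $i$ iff no class predecessor/successor; $\mathsf S$ at $i$ iff $i$ is not last and $i+1$ is the class successor of $i$; $\mathsf P$ at $i$ iff $i\neq1$ and $i-1$ is the class predecessor of $i$;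 $\neg A$ complement; the modalities evaluate the argument at the successor, class successor, predecessor, class predecessor (false if nonexistent); $\mu,\nu$ least/greatest fixpoints. $w\models\varphi$ iff $\varphi$ holds at position 1; the data language (data $\omega$-language) of $\varphi$ is the set of data words (data $\omega$-words) satisfying it. The $\nu$-fragment: formulas in which $\mu$ does not occur. Marking alphabet $\mathcal M=\{\mathsf P,\neg\mathsf P\}\times\{\mathsf S,\neg\mathsf S\}$; the type of $i$ is $(p,s)$ with $s=\mathsf S$ iff $i$ is not last and $i+1$ is the class successor of $i$, and $p=\mathsf P$ iff $i\ne1$ and $i-1$ is the class predecessor of $i$. The marked string projection of $w$ is the sequence of pairs (letter, type). A data automaton $(B,\Sigma',C)$: $B$ is a nondeterministic letter-to-letter finite-state transducer from $\Sigma\times\mathcal M$ to a finite alphabet $\Sigma'$, $C$ a finite automaton over $\Sigma'$. It accepts a data word $w$ iff $B$ has an accepting run on the marked string projection of $w$ producing an output $b_1b_2\cdots$ such that, for the data word $w'=(b_1,d_1)(b_2,d_2)\cdots$, for every class $\{i_1<i_2<\dots\}$ of $w'$ the automaton $C$ accepts $b_{i_1}b_{i_2}\cdots$. A data $\omega$-automaton $(B,\Sigma',C,C_\omega)$ is the same with $B$ a Büchi transducer, $C$ run on finite classes and the Büchi automaton $C_\omega$ run on infinite classes.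
   Formalization: The transducer B carries two sets of accepting states, one for finite words and a Büchi set for infinite words; with one set for both, the "moreover" fails for νx.X^g x on data ω-words with pairwise distinct data values. *)

theory Defs
  imports "HOL-Library.Infinite_Set" "HOL-Library.Nat_Bijection"
begin

section \<open>Data words\<close>

text \<open>Positions are numbered from 0, so the first position is 0.\<close>

datatype 'x word = Fin "'x list" | Inf "nat \<Rightarrow> 'x"

type_synonym ('a, 'd) data_word = "('a \<times> 'd) word"

fun positions :: "'x word \<Rightarrow> nat set" where
  "positions (Fin u) = {..<length u}"
| "positions (Inf f) = UNIV"

fun entry :: "'x word \<Rightarrow> nat \<Rightarrow> 'x" where
  "entry (Fin u) i = u ! i"
| "entry (Inf f) i = f i"

definition letter :: "('a, 'd) data_word \<Rightarrow> nat \<Rightarrow> 'a" where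
  "letter w i = fst (entry w i)"

definition datum :: "('a, 'd) data_word \<Rightarrow> nat \<Rightarrow> 'd" where
  "datum w i = snd (entry w i)"

definition classes :: "('a, 'd) data_word \<Rightarrow> nat set set" where
  "classes w = {K. K \<noteq> {} \<and> (\<exists>d. K = {i \<in> positions w. datum w i = d})}"

definition class_succ :: "('a, 'd) data_word \<Rightarrow> nat \<Rightarrow> nat \<Rightarrow> bool" where
  "class_succ w i j \<longleftrightarrow> i \<in> positions w \<and> j \<in> positions w \<and> i < j \<and> datum w j = datum w i \<and>
     (\<forall>k. i < k \<and> k < j \<longrightarrow> datum w k \<noteq> datum w i)"

definition class_pred :: "('a, 'd) data_word \<Rightarrow> nat \<Rightarrow> nat \<Rightarrow> bool" where
  "class_pred w i j \<longleftrightarrow> i \<in> positions w \<and> j \<in> positions w \<and> j < i \<and> datum w j = datum w i \<and>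
     (\<forall>k. j < k \<and> k < i \<longrightarrow> datum w k \<noteq> datum w i)"

definition S_at :: "('a, 'd) data_word \<Rightarrow> nat \<Rightarrow> bool" where
  "S_at w i \<longleftrightarrow> Suc i \<in> positions w \<and> class_succ w i (Suc i)"

definition P_at :: "('a, 'd) data_word \<Rightarrow> nat \<Rightarrow> bool" where
  "P_at w i \<longleftrightarrow> i \<noteq> 0 \<and> class_pred w i (i - 1)"


section \<open>The \<open>\<mu>\<close>-calculus on data words\<close>

datatype 'a atom = Letter 'a | S_mark | P_mark | FirstG | LastG | FirstC | LastC

datatype modality = XG | XC | YG | YC

datatype 'a formula =
    Var nat
  | Atom "'a atom"
  | NegAtom "'a atom"
  | Mod modality "'a formula"
  | Or "'a formula" "'a formula"
  | And "'a formula" "'a formula"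
  | Mu nat "'a formula"
  | Nu nat "'a formula"

primrec free_vars :: "'a formula \<Rightarrow> nat set" where
  "free_vars (Var x) = {x}"
| "free_vars (Atom A) = {}"
| "free_vars (NegAtom A) = {}"
| "free_vars (Mod m \<phi>) = free_vars \<phi>"
| "free_vars (Or \<phi> \<psi>) = free_vars \<phi> \<union> free_vars \<psi>"
| "free_vars (And \<phi> \<psi>) = free_vars \<phi> \<union> free_vars \<psi>"
| "free_vars (Mu x \<phi>) = free_vars \<phi> - {x}"
| "free_vars (Nu x \<phi>) = free_vars \<phi> - {x}"

definition sentence :: "'a formula \<Rightarrow> bool" where
  "sentence \<phi> \<longleftrightarrow> free_vars \<phi> = {}"

primrec nu_fragment :: "'a formula \<Rightarrow> bool" where
  "nu_fragment (Var x) \<longleftrightarrow> True"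
| "nu_fragment (Atom A) \<longleftrightarrow> True"
| "nu_fragment (NegAtom A) \<longleftrightarrow> True"
| "nu_fragment (Mod m \<phi>) \<longleftrightarrow> nu_fragment \<phi>"
| "nu_fragment (Or \<phi> \<psi>) \<longleftrightarrow> nu_fragment \<phi> \<and> nu_fragment \<psi>"
| "nu_fragment (And \<phi> \<psi>) \<longleftrightarrow> nu_fragment \<phi> \<and> nu_fragment \<psi>"
| "nu_fragment (Mu x \<phi>) \<longleftrightarrow> False"
| "nu_fragment (Nu x \<phi>) \<longleftrightarrow> nu_fragment \<phi>"

primrec atom_holds :: "('a, 'd) data_word \<Rightarrow> nat \<Rightarrow> 'a atom \<Rightarrow> bool" where
  "atom_holds w i (Letter a) \<longleftrightarrow> letter w i = a"
| "atom_holds w i S_mark \<longleftrightarrow> S_at w i"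
| "atom_holds w i P_mark \<longleftrightarrow> P_at w i"
| "atom_holds w i FirstG \<longleftrightarrow> i = 0"
| "atom_holds w i LastG \<longleftrightarrow> Suc i \<notin> positions w"
| "atom_holds w i FirstC \<longleftrightarrow> \<not> (\<exists>j. class_pred w i j)"
| "atom_holds w i LastC \<longleftrightarrow> \<not> (\<exists>j. class_succ w i j)"

primrec step :: "modality \<Rightarrow> ('a, 'd) data_word \<Rightarrow> nat \<Rightarrow> nat \<Rightarrow> bool" where
  "step XG w i j \<longleftrightarrow> j \<in> positions w \<and> j = Suc i"
| "step XC w i j \<longleftrightarrow> class_succ w i j"
| "step YG w i j \<longleftrightarrow> j \<in> positions w \<and> i = Suc j"
| "step YC w i j \<longleftrightarrow> class_pred w i j"

text \<open>
  The intersection in the clause for variables makes every value a set of positions of the word,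
  so the fixpoints over all sets of naturals are the fixpoints over sets of positions.
\<close>

primrec sem :: "('a, 'd) data_word \<Rightarrow> 'a formula \<Rightarrow> (nat \<Rightarrow> nat set) \<Rightarrow> nat set" where
  "sem w (Var x) V = V x \<inter> positions w"
| "sem w (Atom A) V = {i \<in> positions w. atom_holds w i A}"
| "sem w (NegAtom A) V = {i \<in> positions w. \<not> atom_holds w i A}"
| "sem w (Mod m \<phi>) V = {i \<in> positions w. \<exists>j. step m w i j \<and> j \<in> sem w \<phi> V}"
| "sem w (Or \<phi> \<psi>) V = sem w \<phi> V \<union> sem w \<psi> V"
| "sem w (And \<phi> \<psi>) V = sem w \<phi> V \<inter> sem w \<psi> V"
| "sem w (Mu x \<phi>) V = lfp (\<lambda>X. sem w \<phi> (V(x := X)))"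
| "sem w (Nu x \<phi>) V = gfp (\<lambda>X. sem w \<phi> (V(x := X)))"

text \<open>The valuation is irrelevant for sentences. No formula holds in the empty word.\<close>

definition satisfies :: "('a, 'd) data_word \<Rightarrow> 'a formula \<Rightarrow> bool" where
  "satisfies w \<phi> \<longleftrightarrow> 0 \<in> sem w \<phi> (\<lambda>_. {})"

definition data_language :: "'a formula \<Rightarrow> ('a \<times> 'd) list set" where
  "data_language \<phi> = {u. satisfies (Fin u) \<phi>}"

definition data_omega_language :: "'a formula \<Rightarrow> (nat \<Rightarrow> 'a \<times> 'd) set" where
  "data_omega_language \<phi> = {f. satisfies (Inf f) \<phi>}"


section \<open>Data automata\<close>

record ('q, 'b) automaton =
  states :: "'q set"
  initial :: "'q set"
  transitions :: "('q \<times> 'b \<times> 'q) set"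
  accepting :: "'q set"

definition wf_automaton :: "'b set \<Rightarrow> ('q, 'b) automaton \<Rightarrow> bool" where
  "wf_automaton \<Gamma> M \<longleftrightarrow> finite (states M) \<and> initial M \<subseteq> states M \<and> accepting M \<subseteq> states M \<and>
     transitions M \<subseteq> states M \<times> \<Gamma> \<times> states M"

definition accepts :: "('q, 'b) automaton \<Rightarrow> 'b list \<Rightarrow> bool" where
  "accepts M u \<longleftrightarrow> (\<exists>\<rho>. \<rho> 0 \<in> initial M \<and>
     (\<forall>i<length u. (\<rho> i, u ! i, \<rho> (Suc i)) \<in> transitions M) \<and> \<rho> (length u) \<in> accepting M)"

definition buchi_accepts :: "('q, 'b) automaton \<Rightarrow> (nat \<Rightarrow> 'b) \<Rightarrow> bool" where
  "buchi_accepts M f \<longleftrightarrow> (\<exists>\<rho>. \<rho> 0 \<in> initial M \<and>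
     (\<forall>i. (\<rho> i, f i, \<rho> (Suc i)) \<in> transitions M) \<and> (\<exists>\<^sub>\<infinity>i. \<rho> i \<in> accepting M))"

text \<open>
  A transducer is used both on finite words and, as a Buchi transducer, on infinite words. It
  carries one acceptance set for each purpose. With a single set \<open>F\<close> for both, a run over an
  infinite word visiting \<open>F\<close> infinitely often would also be accepting on the prefixes ending
  in \<open>F\<close>. If all data values differ, the prefixes have the same types and the same (singleton)
  class words, so no such automaton could match \<open>\<nu>x. X\<^sup>g x\<close>, which holds in every infinite
  data word and in no finite one.
\<close>

record ('q, 'i, 'o) transducer =
  t_states :: "'q set"
  t_initial :: "'q set"
  t_transitions :: "('q \<times> 'i \<times> 'o \<times> 'q) set"
  t_final :: "'q set"
  t_buchi :: "'q set"

definition wf_transducer :: "'o set \<Rightarrow> ('q, 'i, 'o) transducer \<Rightarrow> bool" where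
  "wf_transducer \<Gamma> B \<longleftrightarrow> finite (t_states B) \<and> t_initial B \<subseteq> t_states B \<and>
     t_final B \<subseteq> t_states B \<and> t_buchi B \<subseteq> t_states B \<and>
     t_transitions B \<subseteq> t_states B \<times> UNIV \<times> \<Gamma> \<times> t_states B"

text \<open>
  The letter of the marked string projection at position \<open>i\<close>; the two Booleans state whether the
  marks \<open>P\<close> and \<open>S\<close> are present.
\<close>

type_synonym 'a marked = "'a \<times> bool \<times> bool"

definition marked_letter :: "('a, 'd) data_word \<Rightarrow> nat \<Rightarrow> 'a marked" where
  "marked_letter w i = (letter w i, P_at w i, S_at w i)"

definition transduces :: "('q, 'a marked, 'o) transducer \<Rightarrow> ('a \<times> 'd) list \<Rightarrow> 'o list \<Rightarrow> bool" where
  "transduces B u v \<longleftrightarrow> length v = length u \<and> (\<exists>\<rho>. \<rho> 0 \<in> t_initial B \<and>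
     (\<forall>i<length u. (\<rho> i, marked_letter (Fin u) i, v ! i, \<rho> (Suc i)) \<in> t_transitions B) \<and>
     \<rho> (length u) \<in> t_final B)"

definition omega_transduces ::
    "('q, 'a marked, 'o) transducer \<Rightarrow> (nat \<Rightarrow> 'a \<times> 'd) \<Rightarrow> (nat \<Rightarrow> 'o) \<Rightarrow> bool" where
  "omega_transduces B f g \<longleftrightarrow> (\<exists>\<rho>. \<rho> 0 \<in> t_initial B \<and>
     (\<forall>i. (\<rho> i, marked_letter (Inf f) i, g i, \<rho> (Suc i)) \<in> t_transitions B) \<and>
     (\<exists>\<^sub>\<infinity>i. \<rho> i \<in> t_buchi B))"

definition finite_class_word :: "('b, 'd) data_word \<Rightarrow> nat set \<Rightarrow> 'b list" where
  "finite_class_word w K = map (letter w) (sorted_list_of_set K)"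

definition infinite_class_word :: "('b, 'd) data_word \<Rightarrow> nat set \<Rightarrow> nat \<Rightarrow> 'b" where
  "infinite_class_word w K n = letter w (enumerate K n)"

text \<open>
  States and output letters are taken to be natural numbers, which is no restriction up to renaming
  as these sets are finite, and makes automata finite objects that an algorithm can output.
\<close>

record 'a data_automaton =
  base :: "(nat, 'a marked, nat) transducer"
  alphabet :: "nat set"
  class_automaton :: "(nat, nat) automaton"

record 'a data_omega_automaton = "'a data_automaton" +
  class_buchi :: "(nat, nat) automaton"

definition wf_data_omega_automaton :: "'a data_omega_automaton \<Rightarrow> bool" where
  "wf_data_omega_automaton \<A> \<longleftrightarrow> finite (alphabet \<A>) \<and> wf_transducer (alphabet \<A>) (base \<A>) \<and>
     wf_automaton (alphabet \<A>) (class_automaton \<A>) \<and> wf_automaton (alphabet \<A>) (class_buchi \<A>)"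

definition automaton_language :: "'a data_automaton \<Rightarrow> ('a \<times> 'd) list set" where
  "automaton_language \<A> = {u. \<exists>v. transduces (base \<A>) u v \<and>
     (let w' = Fin (zip v (map snd u)) in
        \<forall>K \<in> classes w'. accepts (class_automaton \<A>) (finite_class_word w' K))}"

definition automaton_omega_language :: "'a data_omega_automaton \<Rightarrow> (nat \<Rightarrow> 'a \<times> 'd) set" where
  "automaton_omega_language \<A> = {f. \<exists>g. omega_transduces (base \<A>) f g \<and>
     (let w' = Inf (\<lambda>i. (g i, snd (f i))) in
        \<forall>K \<in> classes w'.
          if finite K then accepts (class_automaton \<A>) (finite_class_word w' K)
          else buchi_accepts (class_buchi \<A>) (infinite_class_word w' K))}"


section \<open>Effective constructions\<close>

text \<open>
  The total \<open>n\<close>-ary general recursive functions (zero, successor, projections, composition,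
  primitive recursion, minimisation of regular functions). Only the values on argument lists of
  length \<open>n\<close> are meaningful.
\<close>

inductive recursive :: "nat \<Rightarrow> (nat list \<Rightarrow> nat) \<Rightarrow> bool" where
  zero: "recursive n (\<lambda>_. 0)"
| succ: "recursive 1 (\<lambda>xs. Suc (xs ! 0))"
| proj: "i < n \<Longrightarrow> recursive n (\<lambda>xs. xs ! i)"
| comp: "recursive (length gs) f \<Longrightarrow> \<forall>g \<in> set gs. recursive n g \<Longrightarrow>
     recursive n (\<lambda>xs. f (map (\<lambda>g. g xs) gs))"
| prim_rec: "recursive n f \<Longrightarrow> recursive (Suc (Suc n)) g \<Longrightarrow>
     recursive (Suc n) (\<lambda>xs. rec_nat (f (tl xs)) (\<lambda>k r. g (k # r # tl xs)) (hd xs))"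
| minimise: "recursive (Suc n) f \<Longrightarrow> \<forall>xs. length xs = n \<longrightarrow> (\<exists>y. f (y # xs) = 0) \<Longrightarrow>
     recursive n (\<lambda>xs. LEAST y. f (y # xs) = 0)"

text \<open>Goedel numberings, relative to a numbering \<open>c\<close> of the finite alphabet.\<close>

primrec atom_code :: "('a \<Rightarrow> nat) \<Rightarrow> 'a atom \<Rightarrow> nat" where
  "atom_code c (Letter a) = list_encode [0, c a]"
| "atom_code c S_mark = list_encode [1]"
| "atom_code c P_mark = list_encode [2]"
| "atom_code c FirstG = list_encode [3]"
| "atom_code c LastG = list_encode [4]"
| "atom_code c FirstC = list_encode [5]"
| "atom_code c LastC = list_encode [6]"

primrec modality_code :: "modality \<Rightarrow> nat" where
  "modality_code XG = 0"
| "modality_code XC = 1"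
| "modality_code YG = 2"
| "modality_code YC = 3"

primrec formula_code :: "('a \<Rightarrow> nat) \<Rightarrow> 'a formula \<Rightarrow> nat" where
  "formula_code c (Var x) = list_encode [0, x]"
| "formula_code c (Atom A) = list_encode [1, atom_code c A]"
| "formula_code c (NegAtom A) = list_encode [2, atom_code c A]"
| "formula_code c (Mod m \<phi>) = list_encode [3, modality_code m, formula_code c \<phi>]"
| "formula_code c (Or \<phi> \<psi>) = list_encode [4, formula_code c \<phi>, formula_code c \<psi>]"
| "formula_code c (And \<phi> \<psi>) = list_encode [5, formula_code c \<phi>, formula_code c \<psi>]"
| "formula_code c (Mu x \<phi>) = list_encode [6, x, formula_code c \<phi>]"
| "formula_code c (Nu x \<phi>) = list_encode [7, x, formula_code c \<phi>]"

definition automaton_code :: "(nat, nat) automaton \<Rightarrow> nat" where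
  "automaton_code M = list_encode
     [set_encode (states M), set_encode (initial M),
      set_encode ((\<lambda>(p, b, q). list_encode [p, b, q]) ` transitions M),
      set_encode (accepting M)]"

definition transducer_code :: "('a \<Rightarrow> nat) \<Rightarrow> (nat, 'a marked, nat) transducer \<Rightarrow> nat" where
  "transducer_code c B = list_encode
     [set_encode (t_states B), set_encode (t_initial B),
      set_encode ((\<lambda>(p, (a, m, s), b, q). list_encode [p, c a, of_bool m, of_bool s, b, q])
        ` t_transitions B),
      set_encode (t_final B), set_encode (t_buchi B)]"

definition data_omega_automaton_code :: "('a \<Rightarrow> nat) \<Rightarrow> 'a data_omega_automaton \<Rightarrow> nat" where
  "data_omega_automaton_code c \<A> = list_encode
     [transducer_code c (base \<A>), set_encode (alphabet \<A>),
      automaton_code (class_automaton \<A>), automaton_code (class_buchi \<A>)]"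

definition effectively_constructed ::
    "('a \<Rightarrow> nat) \<Rightarrow> 'a formula set \<Rightarrow> ('a formula \<Rightarrow> 'a data_omega_automaton) \<Rightarrow> bool" where
  "effectively_constructed c \<Phi> T \<longleftrightarrow>
     (\<exists>f. recursive 1 f \<and>
       (\<forall>\<phi> \<in> \<Phi>. f [formula_code c \<phi>] = data_omega_automaton_code c (T \<phi>)))"


subsection \<open>The numberings are injective\<close>

lemma atom_code_inj: "inj c \<Longrightarrow> atom_code c A = atom_code c A' \<Longrightarrow> A = A'"
  by (cases A; cases A') (simp_all del: list_encode.simps add: list_encode_eq inj_eq)

lemma modality_code_inj: "modality_code m = modality_code m' \<Longrightarrow> m = m'"
  by (cases m; cases m') simp_all

lemma formula_code_inj:
  assumes "inj c"
  shows "inj (formula_code c)"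
proof (rule injI)
  show "formula_code c \<phi> = formula_code c \<psi> \<Longrightarrow> \<phi> = \<psi>" for \<phi> \<psi>
  proof (induction \<phi> arbitrary: \<psi>)
    case (Var x)
    then show ?case by (cases \<psi>) (simp_all del: list_encode.simps add: list_encode_eq)
  next
    case (Atom A)
    then show ?case
      by (cases \<psi>) (auto simp del: list_encode.simps simp: list_encode_eq dest: atom_code_inj[OF assms])
  next
    case (NegAtom A)
    then show ?case
      by (cases \<psi>) (auto simp del: list_encode.simps simp: list_encode_eq dest: atom_code_inj[OF assms])
  next
    case (Mod m \<phi>)
    then show ?case
      by (cases \<psi>) (auto simp del: list_encode.simps simp: list_encode_eq dest: modality_code_inj)
  next
    case (Or \<phi>1 \<phi>2)
    then show ?case by (cases \<psi>) (auto simp del: list_encode.simps simp: list_encode_eq)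
  next
    case (And \<phi>1 \<phi>2)
    then show ?case by (cases \<psi>) (auto simp del: list_encode.simps simp: list_encode_eq)
  next
    case (Mu x \<phi>)
    then show ?case by (cases \<psi>) (auto simp del: list_encode.simps simp: list_encode_eq)
  next
    case (Nu x \<phi>)
    then show ?case by (cases \<psi>) (auto simp del: list_encode.simps simp: list_encode_eq)
  qed
qed

lemma automaton_code_inj:
  assumes "wf_automaton \<Gamma> M" "wf_automaton \<Gamma>' M'" "finite \<Gamma>" "finite \<Gamma>'"
    and "automaton_code M = automaton_code M'"
  shows "M = M'"
proof -
  let ?h = "\<lambda>(p, b, q). list_encode [p, b, q]"
  have fin: "finite (transitions M)" "finite (transitions M')"
    using assms(1-4) unfolding wf_automaton_def
    by (meson finite_SigmaI finite_subset)+
  have inj: "inj ?h"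
    by (auto simp del: list_encode.simps simp: list_encode_eq intro!: injI)
  have "states M = states M'" "initial M = initial M'" "accepting M = accepting M'"
    "?h ` transitions M = ?h ` transitions M'"
    using assms fin unfolding wf_automaton_def automaton_code_def
    by (auto simp del: list_encode.simps simp: list_encode_eq set_encode_eq finite_subset)
  then show ?thesis
    using inj by (auto simp: inj_image_eq_iff intro!: automaton.equality)
qed

lemma transducer_code_inj:
  fixes B B' :: "(nat, 'a::finite marked, nat) transducer"
  assumes "inj c" "wf_transducer \<Gamma> B" "wf_transducer \<Gamma>' B'" "finite \<Gamma>" "finite \<Gamma>'"
    and "transducer_code c B = transducer_code c B'"
  shows "B = B'"
proof -
  let ?h = "\<lambda>(p, (a, m, s), b, q). list_encode [p, c a, of_bool m, of_bool s, b, q]"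
  have fin: "finite (t_transitions B)" "finite (t_transitions B')"
    using assms(2-5) unfolding wf_transducer_def
    by (meson finite_SigmaI finite_subset finite_code)+
  have inj: "inj ?h"
    using assms(1) by (auto simp del: list_encode.simps simp: list_encode_eq inj_eq of_bool_def split: if_splits intro!: injI)
  have "t_states B = t_states B'" "t_initial B = t_initial B'"
    "t_final B = t_final B'" "t_buchi B = t_buchi B'"
    "?h ` t_transitions B = ?h ` t_transitions B'"
    using assms fin unfolding wf_transducer_def transducer_code_def
    by (auto simp del: list_encode.simps simp: list_encode_eq set_encode_eq finite_subset)
  then show ?thesis
    using inj by (auto simp: inj_image_eq_iff intro!: transducer.equality)
qed

lemma data_omega_automaton_code_inj:
  fixes c :: "'a::finite \<Rightarrow> nat"
  assumes "inj c"
  shows "inj_on (data_omega_automaton_code c) {\<A>. wf_data_omega_automaton \<A>}"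
proof (rule inj_onI)
  fix \<A> \<A>' :: "'a data_omega_automaton"
  assume wf: "\<A> \<in> {\<A>. wf_data_omega_automaton \<A>}" "\<A>' \<in> {\<A>. wf_data_omega_automaton \<A>}"
    and eq: "data_omega_automaton_code c \<A> = data_omega_automaton_code c \<A>'"
  have "base \<A> = base \<A>'"
    using wf eq transducer_code_inj[OF assms]
    unfolding wf_data_omega_automaton_def data_omega_automaton_code_def
    by (auto simp del: list_encode.simps simp: list_encode_eq)
  moreover have "alphabet \<A> = alphabet \<A>'"
    using wf eq unfolding wf_data_omega_automaton_def data_omega_automaton_code_def
    by (auto simp del: list_encode.simps simp: list_encode_eq set_encode_eq)
  moreover have "class_automaton \<A> = class_automaton \<A>'" "class_buchi \<A> = class_buchi \<A>'"
    using wf eq automaton_code_inj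
    unfolding wf_data_omega_automaton_def data_omega_automaton_code_def
    by (auto simp del: list_encode.simps simp: list_encode_eq)
  ultimately show "\<A> = \<A>'"
    by (auto intro!: data_omega_automaton.equality)
qed

end

theory Submission
  imports Defs
begin

text \<open>
  Only greatest fixpoints occur in \<open>\<phi>\<close>, so \<open>\<phi>\<close> holds at the first position iff the positions can be
  labelled with sets of obligations that are locally consistent and put \<open>\<phi>\<close> at the first position.
  An obligation is a subformula together with the stack of \<open>\<nu>\<close>-formulas that enclose it; unfolding a
  \<open>\<nu>\<close>-formula pushes it, and a variable is resolved by popping the stack, so every condition is local
  even if the same variable is bound several times. The base transducer guesses the labels,
  checks the Boolean conditions and those for the global modalities, and outputs the labels; the class
  automata check the conditions for the class modalities.

  On codes, an obligation is a number below a primitive recursive bound in the code of \<open>\<phi>\<close>, a label is the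
  code of a finite set of numbers, and all conditions are arithmetical with bounded quantifiers. Hence the
  code of the automaton is a recursive function of the code of the formula.
\<close>

text \<open>A greatest fixpoint may be postponed forever, so nothing like well-foundedness has to be
  checked: tests on neighbouring labels suffice, and every infinite run may be accepting. Only the
  ends of finite words and finite classes give an acceptance condition. Past modalities cost
  nothing, since labels are guessed and a test on two neighbours can be read in either direction.
  The output is the label itself because a class automaton sees only the output letters of its
  class.

  The two directions use different labellings. Soundness holds for every consistent labelling, even
  one containing numbers that code nothing. Completeness labels each position with all obligations
  that are true there, and the obstacle is finiteness, as stacks are unbounded in general. It is
  removed by admitting only lists of strictly increasing codes up to the code \<open>n\<close> of
  the formula, hence of length at most \<open>Suc n\<close>. This also replaces a subformula
  closure: the automaton depends on \<open>n\<close> as a mere number, and the formula is never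
  decoded to build it.\<close>

section \<open>Computable functions and decidable predicates\<close>

text \<open>
  Arguments are environments assigning values to de Bruijn indices, so that binders in the rules below
  shift the environment and higher-order unification applies the rules automatically.
\<close>

definition computable :: "((nat \<Rightarrow> nat) \<Rightarrow> nat) \<Rightarrow> bool" where
  "computable F \<longleftrightarrow> (\<exists>n g. recursive n g \<and> (\<forall>e. F e = g (map e [0..<n])))"

definition decidable :: "((nat \<Rightarrow> nat) \<Rightarrow> bool) \<Rightarrow> bool" where
  "decidable P \<longleftrightarrow> computable (\<lambda>e. of_bool (P e))"

lemma recursive_weaken:
  assumes "recursive n g" "n \<le> m"
  shows "\<exists>g'. recursive m g' \<and> (\<forall>e. g (map e [0..<n]) = g' (map e [0..<m]))"
proof -
  let ?gs = "map (\<lambda>i xs. xs ! i) [0..<n] :: (nat list \<Rightarrow> nat) list"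
  have "recursive m (\<lambda>xs. g (map (\<lambda>p. p xs) ?gs))"
    using assms by (intro recursive.comp) (auto intro: recursive.proj)
  moreover have "g (map e [0..<n]) = g (map (\<lambda>p. p (map e [0..<m])) ?gs)" for e
    using assms(2) by (auto intro!: arg_cong[where f = g])
  ultimately show ?thesis by blast
qed

text \<open>Every sufficiently large arity works, so several functions can be brought to one common
  environment length before they are combined.\<close>

lemma computable_any_arity:
  assumes "computable F"
  shows "\<exists>n0. \<forall>n\<ge>n0. \<exists>g. recursive n g \<and> (\<forall>e. F e = g (map e [0..<n]))"
  using assms recursive_weaken unfolding computable_def by metis

named_theorems computable_intros

lemma computable_const [computable_intros]: "computable (\<lambda>e. k)"
proof -
  have "recursive 0 (\<lambda>xs. k)"
  proof (induction k)
    case (Suc k)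
    have "recursive 0 (\<lambda>xs. Suc (map (\<lambda>g. g xs) [\<lambda>xs. k] ! 0))"
      using Suc by (intro recursive.comp) (auto intro: recursive.succ[simplified])
    then show ?case by simp
  qed (rule recursive.zero)
  then show ?thesis unfolding computable_def by blast
qed

lemma computable_var [computable_intros]: "computable (\<lambda>e. e i)"
proof -
  have "e i = map e [0..<Suc i] ! i" for e :: "nat \<Rightarrow> nat"
    by (simp del: upt_Suc)
  then show ?thesis unfolding computable_def using recursive.proj[of i "Suc i"] by blast
qed

lemma computable_Suc [computable_intros]:
  assumes "computable F"
  shows "computable (\<lambda>e. Suc (F e))"
proof -
  obtain n g where g: "recursive n g" "\<And>e. F e = g (map e [0..<n])"
    using assms unfolding computable_def by blast
  have "recursive n (\<lambda>xs. Suc (map (\<lambda>g. g xs) [g] ! 0))"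
    using g by (intro recursive.comp) (auto intro: recursive.succ[simplified])
  then show ?thesis unfolding computable_def using g by auto
qed

lemma map_env_Cons:
  "k # map e [0..<n] = map (\<lambda>i. case i of 0 \<Rightarrow> k | Suc i \<Rightarrow> e i) [0..<Suc n]"
  by (simp add: upt_conv_Cons map_Suc_upt[symmetric] o_def del: upt_Suc)

text \<open>In the body \<open>H\<close> the counter is index 0, the previous value is index 1, and
  the parameters start at index 2. Since \<open>prim_rec\<close> recurses on its first argument, it
  is composed with the recursion depth followed by the projections.\<close>

lemma computable_rec_nat [computable_intros]:
  assumes "computable T" "computable F" "computable (\<lambda>e. H (e 0) (e 1) (\<lambda>i. e (Suc (Suc i))))"
  shows "computable (\<lambda>e. rec_nat (F e) (\<lambda>k r. H k r e) (T e))"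
proof -
  obtain n where n: "\<exists>g. recursive n g \<and> (\<forall>e. T e = g (map e [0..<n]))"
      "\<exists>g. recursive n g \<and> (\<forall>e. F e = g (map e [0..<n]))"
      "\<exists>g. recursive (Suc (Suc n)) g \<and> (\<forall>e. H (e 0) (e 1) (\<lambda>i. e (Suc (Suc i))) = g (map e [0..<Suc (Suc n)]))"
  proof -
    obtain a b c where "\<forall>n\<ge>a. \<exists>g. recursive n g \<and> (\<forall>e. T e = g (map e [0..<n]))"
      "\<forall>n\<ge>b. \<exists>g. recursive n g \<and> (\<forall>e. F e = g (map e [0..<n]))"
      "\<forall>n\<ge>c. \<exists>g. recursive n g \<and> (\<forall>e. H (e 0) (e 1) (\<lambda>i. e (Suc (Suc i))) = g (map e [0..<n]))"
      using assms[THEN computable_any_arity] by blast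
    then show ?thesis using that[of "a + b + c"] by (simp del: upt_Suc)
  qed
  then obtain gT gF gH where g: "recursive n gT" "\<And>e. T e = gT (map e [0..<n])"
    "recursive n gF" "\<And>e. F e = gF (map e [0..<n])" "recursive (Suc (Suc n)) gH"
    "\<And>e. H (e 0) (e 1) (\<lambda>i. e (Suc (Suc i))) = gH (map e [0..<Suc (Suc n)])"
    by auto
  let ?R = "\<lambda>xs. rec_nat (gF (tl xs)) (\<lambda>k r. gH (k # r # tl xs)) (hd xs)"
  let ?gs = "gT # map (\<lambda>i xs. xs ! i) [0..<n]"
  have H: "H k r e = gH (k # r # map e [0..<n])" for k r e
    using g(6)[of "case_nat k (case_nat r e)"] by (simp add: map_env_Cons del: upt_Suc)
  have "recursive n (\<lambda>xs. ?R (map (\<lambda>p. p xs) ?gs))"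
    using recursive.prim_rec[OF g(3,5)] g(1) by (intro recursive.comp) (auto intro: recursive.proj)
  moreover have nth: "map ((!) (map e [0..<n])) [0..<n] = map e [0..<n]" for e :: "nat \<Rightarrow> nat"
    using map_nth[of "map e [0..<n]"] by simp
  have "rec_nat (F e) (\<lambda>k r. H k r e) (T e) = ?R (map (\<lambda>p. p (map e [0..<n])) ?gs)" for e
    by (simp add: g(2,4) H o_def nth)
  ultimately show ?thesis unfolding computable_def by blast
qed

text \<open>Only the first \<open>m\<close> indices influence \<open>H\<close>, so the arity
  thresholds of finitely many substituted functions have a maximum.\<close>

lemma computable_subst:
  assumes "computable H" "\<And>i. computable (Fs i)"
  shows "computable (\<lambda>e. H (\<lambda>i. Fs i e))"
proof -
  obtain m h where h: "recursive m h" "\<And>e. H e = h (map e [0..<m])"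
    using assms(1) unfolding computable_def by blast
  have "\<exists>n. \<forall>i<m. \<exists>g. recursive n g \<and> (\<forall>e. Fs i e = g (map e [0..<n]))"
  proof -
    obtain b where b: "\<And>i n. n \<ge> b i \<Longrightarrow> \<exists>g. recursive n g \<and> (\<forall>e. Fs i e = g (map e [0..<n]))"
      using computable_any_arity[OF assms(2)] by metis
    have "b i \<le> Max (b ` {..<m})" if "i < m" for i
      using that by simp
    then show ?thesis using b by blast
  qed
  then obtain n g where g: "\<And>i. i < m \<Longrightarrow> recursive n (g i)"
      "\<And>i e. i < m \<Longrightarrow> Fs i e = g i (map e [0..<n])"
    by metis
  let ?gs = "map g [0..<m]"
  have "recursive n (\<lambda>xs. h (map (\<lambda>p. p xs) ?gs))"
    using h(1) g(1) by (intro recursive.comp) auto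
  moreover have "H (\<lambda>i. Fs i e) = h (map (\<lambda>p. p (map e [0..<n])) ?gs)" for e
    by (auto simp: h(2) g(2) intro!: arg_cong[where f = h])
  ultimately show ?thesis unfolding computable_def by blast
qed

lemma computable_lift1:
  assumes "computable (\<lambda>e. h (e 0))" "computable F"
  shows "computable (\<lambda>e. h (F e))"
  using computable_subst[OF assms(1), of "\<lambda>_. F"] assms(2) by simp

lemma computable_lift2:
  assumes "computable (\<lambda>e. h (e 0) (e 1))" "computable F" "computable G"
  shows "computable (\<lambda>e. h (F e) (G e))"
  using computable_subst[OF assms(1), of "\<lambda>i. if i = 0 then F else G"] assms(2,3) by simp

lemma computable_lift4:
  assumes "computable (\<lambda>e. h (e 0) (e 1) (e 2) (e 3))"
    "computable F" "computable G" "computable H" "computable I"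
  shows "computable (\<lambda>e. h (F e) (G e) (H e) (I e))"
  using computable_subst[OF assms(1),
      of "\<lambda>i. if i = 0 then F else if i = 1 then G else if i = 2 then H else I"] assms(2-5)
  by simp

lemma computable_add [computable_intros]:
  assumes "computable F" "computable G"
  shows "computable (\<lambda>e. F e + G e)"
proof -
  have "m + n = rec_nat m (\<lambda>_ r. Suc r) n" for m n by (induction n) auto
  then show ?thesis by (simp, intro computable_intros assms)
qed

lemma computable_mult [computable_intros]:
  assumes "computable F" "computable G"
  shows "computable (\<lambda>e. F e * G e)"
proof (rule computable_lift2[OF _ assms])
  have *: "m * n = rec_nat 0 (\<lambda>_ r. r + m) n" for m n :: nat by (induction n) auto
  show "computable (\<lambda>e. e 0 * e 1)"
    by (subst *, intro computable_intros)
qed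

lemma computable_power [computable_intros]:
  assumes "computable F" "computable G"
  shows "computable (\<lambda>e. F e ^ G e)"
proof (rule computable_lift2[OF _ assms])
  have *: "m ^ n = rec_nat 1 (\<lambda>_ r. r * m) n" for m n :: nat by (induction n) auto
  show "computable (\<lambda>e. e 0 ^ e 1)"
    by (subst *, intro computable_intros)
qed

lemma computable_diff [computable_intros]:
  assumes "computable F" "computable G"
  shows "computable (\<lambda>e. F e - G e)"
proof (rule computable_lift2[OF _ assms])
  have pred: "m - Suc 0 = rec_nat 0 (\<lambda>k _. k) m" for m by (cases m) auto
  have diff: "m - n = rec_nat m (\<lambda>_ r. rec_nat 0 (\<lambda>k _. k) r) n" for m n
    by (induction n) (auto simp flip: pred)
  show "computable (\<lambda>e. e 0 - e 1)"
    by (subst diff, intro computable_intros)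
qed

lemma computable_sum [computable_intros]:
  assumes "computable B" "computable (\<lambda>e. F (e 0) (\<lambda>i. e (Suc i)))"
  shows "computable (\<lambda>e. \<Sum>k<B e. F k e)"
proof -
  have *: "(\<Sum>k<b. F k e) = rec_nat 0 (\<lambda>k r. r + F k e) b" for b e
    by (induction b) auto
  have "computable (\<lambda>e. F (e 0) (\<lambda>i. e (Suc (Suc i))))"
    \<comment> \<open>The recursion inserts its accumulator at index 1; this renaming moves the
      parameters past it.\<close>
    using computable_subst[OF assms(2), of "\<lambda>i. case i of 0 \<Rightarrow> \<lambda>e. e 0 | Suc i \<Rightarrow> \<lambda>e. e (Suc (Suc i))"]
    by (simp add: computable_var split: nat.split)
  then show ?thesis
    by (subst *) (intro computable_intros assms)
qed

lemma computable_prod_encode [computable_intros]: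
  assumes "computable F" "computable G"
  shows "computable (\<lambda>e. prod_encode (F e, G e))"
proof -
  have *: "triangle n = rec_nat 0 (\<lambda>k r. r + Suc k) n" for n by (induction n) auto
  show ?thesis by (simp add: prod_encode_def *, intro computable_intros assms)
qed

lemma computable_list_encode_Cons [computable_intros]:
  assumes "computable F" "computable (\<lambda>e. list_encode (G e))"
  shows "computable (\<lambda>e. list_encode (F e # G e))"
  unfolding list_encode.simps by (intro computable_intros assms)

section \<open>Truth values, bounded quantifiers and sets coded by binary digits\<close>

lemma decidable_zero: "computable F \<Longrightarrow> decidable (\<lambda>e. F e = 0)"
proof -
  have *: "of_bool (m = 0) = rec_nat 1 (\<lambda>_ _. 0) m" for m :: nat by (cases m) auto
  show "computable F \<Longrightarrow> decidable (\<lambda>e. F e = 0)"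
    unfolding decidable_def by (subst *) (intro computable_intros)
qed

lemma decidable_not [computable_intros]: "decidable P \<Longrightarrow> decidable (\<lambda>e. \<not> P e)"
  using decidable_zero[of "\<lambda>e. of_bool (P e)"] by (simp add: decidable_def)

lemma decidable_conj [computable_intros]:
  "decidable P \<Longrightarrow> decidable Q \<Longrightarrow> decidable (\<lambda>e. P e \<and> Q e)"
  unfolding decidable_def of_bool_conj by (intro computable_intros)

lemma decidable_disj [computable_intros]:
  assumes "decidable P" "decidable Q"
  shows "decidable (\<lambda>e. P e \<or> Q e)"
proof -
  have "decidable (\<lambda>e. \<not> (\<not> P e \<and> \<not> Q e))"
    using assms by (intro computable_intros)
  then show ?thesis by simp
qed

lemma decidable_imp [computable_intros]:
  assumes "decidable P" "decidable Q"
  shows "decidable (\<lambda>e. P e \<longrightarrow> Q e)"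
proof -
  have "decidable (\<lambda>e. \<not> P e \<or> Q e)"
    using assms by (intro computable_intros)
  then show ?thesis by simp
qed

lemma decidable_le [computable_intros]:
  "computable F \<Longrightarrow> computable G \<Longrightarrow> decidable (\<lambda>e. F e \<le> G e)"
  using decidable_zero[of "\<lambda>e. F e - G e"] computable_diff[of F G] by simp

lemma decidable_less [computable_intros]:
  "computable F \<Longrightarrow> computable G \<Longrightarrow> decidable (\<lambda>e. F e < G e)"
  unfolding Suc_le_eq[symmetric] by (intro computable_intros)

lemma decidable_eq [computable_intros]:
  "computable F \<Longrightarrow> computable G \<Longrightarrow> decidable (\<lambda>e. F e = G e)"
  unfolding eq_iff by (intro computable_intros)

lemma decidable_bex [computable_intros]:
  assumes "computable B" "decidable (\<lambda>e. P (e 0) (\<lambda>i. e (Suc i)))"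
  shows "decidable (\<lambda>e. \<exists>k\<le>B e. P k e)"
proof -
  have "(\<exists>k\<le>b. P k e) \<longleftrightarrow> \<not> (\<Sum>k<Suc b. of_bool (P k e)) = (0::nat)" for b e
    by (auto simp: less_Suc_eq_le simp del: sum.lessThan_Suc)
  moreover have "decidable (\<lambda>e. \<not> (\<Sum>k<Suc (B e). of_bool (P k e)) = (0::nat))"
    using assms by (intro computable_intros) (simp_all add: decidable_def)
  ultimately show ?thesis by simp
qed

lemma decidable_ball [computable_intros]:
  assumes "computable B" "decidable (\<lambda>e. P (e 0) (\<lambda>i. e (Suc i)))"
  shows "decidable (\<lambda>e. \<forall>k\<le>B e. P k e)"
proof -
  have "decidable (\<lambda>e. \<not> (\<exists>k\<le>B e. \<not> P k e))"
    using assms by (intro computable_intros)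
  then show ?thesis by simp
qed

text \<open>A set code is a sum of powers of two, hence a bounded sum once membership is decidable.
  Computing the code of an automaton thereby reduces to deciding membership in bounded
  comprehensions.\<close>

lemma computable_set_encode [computable_intros]:
  assumes "computable B" "decidable (\<lambda>e. P (e 0) (\<lambda>i. e (Suc i)))"
  shows "computable (\<lambda>e. set_encode {k. k \<le> B e \<and> P k e})"
proof -
  have *: "set_encode {k. k \<le> b \<and> P k e} = (\<Sum>k<Suc b. of_bool (P k e) * 2 ^ k)" for b e
    by (auto simp: set_encode_def less_Suc_eq_le intro!: sum.mono_neutral_cong_left simp del: sum.lessThan_Suc)
  show ?thesis
    unfolding * using assms by (intro computable_intros) (simp_all only: decidable_def)
qed

text \<open>Bit \<open>x\<close> of \<open>b\<close> is set iff
  \<open>b = (2 * q + 1) * 2 ^ x + r\<close> with \<open>r < 2 ^ x\<close>. This form avoids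
  division, and \<open>b\<close> bounds both witnesses.\<close>

lemma decidable_set_decode [computable_intros]:
  assumes "computable F" "computable G"
  shows "decidable (\<lambda>e. F e \<in> set_decode (G e))"
proof -
  have "x \<in> set_decode b \<longleftrightarrow> (\<exists>q\<le>b. \<exists>r\<le>b. r < 2 ^ x \<and> b = (2 * q + 1) * 2 ^ x + r)" for x b :: nat
  proof
    assume "x \<in> set_decode b"
    then have "b div 2 ^ x = 2 * (b div 2 ^ x div 2) + 1"
      by (simp add: set_decode_def)
    moreover have "b = b div 2 ^ x * 2 ^ x + b mod 2 ^ x"
      by (simp only: div_mult_mod_eq)
    ultimately have "b = (2 * (b div 2 ^ x div 2) + 1) * 2 ^ x + b mod 2 ^ x"
      by metis
    then show "\<exists>q\<le>b. \<exists>r\<le>b. r < 2 ^ x \<and> b = (2 * q + 1) * 2 ^ x + r"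
      by (metis div_le_dividend le_trans mod_less_divisor mod_less_eq_dividend zero_less_numeral zero_less_power)
  next
    assume "\<exists>q\<le>b. \<exists>r\<le>b. r < 2 ^ x \<and> b = (2 * q + 1) * 2 ^ x + r"
    then obtain q r where "r < 2 ^ x" "b = (2 * q + 1) * 2 ^ x + r" by blast
    then have "b div 2 ^ x = 2 * q + 1" by (simp del: mult_Suc add: div_mult_self3)
    then show "x \<in> set_decode b" by (simp add: set_decode_def)
  qed
  moreover have "decidable (\<lambda>e. \<exists>q\<le>e 1. \<exists>r\<le>e 1. r < 2 ^ e 0 \<and> e 1 = (2 * q + 1) * 2 ^ e 0 + r)"
    by (intro computable_intros)
  ultimately have "computable (\<lambda>e. of_bool (e 0 \<in> set_decode (e 1)))"
    by (simp add: decidable_def)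
  from computable_lift2[OF this assms] show ?thesis
    by (simp add: decidable_def)
qed

text \<open>The constant environment \<open>\<lambda>_. x\<close> fits every arity, so
  \<open>g\<close> receives \<open>n\<close> copies of the one argument.\<close>

lemma computable_recursive:
  assumes "computable (\<lambda>e. F (e 0))"
  shows "\<exists>f. recursive 1 f \<and> (\<forall>x. f [x] = F x)"
proof -
  obtain n g where g: "recursive n g" "\<And>e. F (e 0) = g (map e [0..<n])"
    using assms unfolding computable_def by blast
  let ?gs = "replicate n (\<lambda>xs. xs ! 0)"
  have "recursive 1 (\<lambda>xs. g (map (\<lambda>p. p xs) ?gs))"
    using g(1) by (intro recursive.comp) (auto intro: recursive.proj)
  moreover have "F x = g (map (\<lambda>p. p [x]) ?gs)" for x
    using g(2)[of "\<lambda>_. x"] by (simp add: map_replicate_const)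
  ultimately show ?thesis by metis
qed

section \<open>Labels and their local conditions\<close>

declare list_encode.simps [simp del] set_decode_Suc [simp del]

text \<open>
  The first argument is the code of a formula, the second that of a stack: this is the list code of the
  stack with the formula in front. In the following definitions, 1 and 2 tag (negated) atoms, 3 modalities,
  and 4, 5, 7, 0 tag disjunctions, conjunctions, greatest fixpoints and variables; the parameters
  \<open>X\<close>, \<open>Y\<close> are modality codes, \<open>F\<close>, \<open>L\<close> the codes of the atoms for first and last positions.
\<close>

abbreviation item :: "nat \<Rightarrow> nat \<Rightarrow> nat" where
  "item f E \<equiv> Suc (prod_encode (f, E))"

definition item_code :: "('a \<Rightarrow> nat) \<Rightarrow> 'a formula list \<Rightarrow> nat" where
  "item_code c xs = list_encode (map (formula_code c) xs)"

lemma item_code_simps [simp]: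
  "item_code c [] = 0"
  "item_code c (\<phi> # E) = item (formula_code c \<phi>) (item_code c E)"
  by (simp_all add: item_code_def list_encode.simps)

definition has_atom :: "nat \<Rightarrow> nat \<Rightarrow> nat \<Rightarrow> bool" where
  "has_atom k A b \<longleftrightarrow> (\<exists>E. item (list_encode [k, list_encode [A]]) E \<in> set_decode b)"

definition no_mod :: "nat \<Rightarrow> nat \<Rightarrow> bool" where
  "no_mod m b \<longleftrightarrow> (\<forall>f E. item (list_encode [3, m, f]) E \<notin> set_decode b)"

definition mod_step :: "nat \<Rightarrow> nat \<Rightarrow> nat \<Rightarrow> bool" where
  "mod_step m b b' \<longleftrightarrow>
    (\<forall>f E. item (list_encode [3, m, f]) E \<in> set_decode b \<longrightarrow> item f E \<in> set_decode b')"

definition starts :: "nat \<Rightarrow> nat \<Rightarrow> nat \<Rightarrow> bool" where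
  "starts Y F b \<longleftrightarrow> no_mod Y b \<and> \<not> has_atom 2 F b"

definition links :: "nat \<Rightarrow> nat \<Rightarrow> nat \<Rightarrow> nat \<Rightarrow> nat \<Rightarrow> nat \<Rightarrow> bool" where
  "links X Y F L b b' \<longleftrightarrow>
    mod_step X b b' \<and> mod_step Y b' b \<and> \<not> has_atom 1 L b \<and> \<not> has_atom 1 F b'"

definition ends :: "nat \<Rightarrow> nat \<Rightarrow> nat \<Rightarrow> bool" where
  "ends X L b \<longleftrightarrow> no_mod X b \<and> \<not> has_atom 2 L b"

text \<open>As \<open>item\<close> prepends a formula to a list code, the code of a nonempty stack
  is itself the obligation of its top formula. In the last clause \<open>E\<close> therefore serves
  as the obligation of the binding fixpoint if the top binds \<open>x\<close>; otherwise the top is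
  popped. The empty stack has code 0, which is no item, so a label never contains an unbound
  variable, in accordance with the empty valuation.\<close>

definition local_ok :: "nat \<Rightarrow> nat \<Rightarrow> nat \<Rightarrow> nat \<Rightarrow> bool" where
  "local_ok a p s b \<longleftrightarrow>
    (\<forall>l E. item (list_encode [1, list_encode [0, l]]) E \<in> set_decode b \<longrightarrow> l = a) \<and>
    (\<forall>E. item (list_encode [2, list_encode [0, a]]) E \<notin> set_decode b) \<and>
    (has_atom 1 1 b \<longrightarrow> s = 1) \<and> (has_atom 2 1 b \<longrightarrow> s = 0) \<and>
    (has_atom 1 2 b \<longrightarrow> p = 1) \<and> (has_atom 2 2 b \<longrightarrow> p = 0) \<and>
    (\<forall>f g E. item (list_encode [4, f, g]) E \<in> set_decode b \<longrightarrow>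
      item f E \<in> set_decode b \<or> item g E \<in> set_decode b) \<and>
    (\<forall>f g E. item (list_encode [5, f, g]) E \<in> set_decode b \<longrightarrow>
      item f E \<in> set_decode b \<and> item g E \<in> set_decode b) \<and>
    (\<forall>x f E. item (list_encode [7, x, f]) E \<in> set_decode b \<longrightarrow>
      item f (item (list_encode [7, x, f]) E) \<in> set_decode b) \<and>
    (\<forall>x E. item (list_encode [0, x]) E \<in> set_decode b \<longrightarrow>
      (\<exists>y f D. E = item (list_encode [7, y, f]) D \<and>
        (x = y \<and> E \<in> set_decode b \<or> x \<noteq> y \<and> item (list_encode [0, x]) D \<in> set_decode b)))"

lemma local_okD:
  assumes "local_ok a p s b"
  shows "item (list_encode [1, list_encode [0, l]]) E \<in> set_decode b \<Longrightarrow> l = a"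
    and "item (list_encode [2, list_encode [0, a]]) E \<notin> set_decode b"
    and "has_atom 1 1 b \<Longrightarrow> s = 1" and "has_atom 2 1 b \<Longrightarrow> s = 0"
    and "has_atom 1 2 b \<Longrightarrow> p = 1" and "has_atom 2 2 b \<Longrightarrow> p = 0"
    and "item (list_encode [4, f, g]) E \<in> set_decode b \<Longrightarrow>
      item f E \<in> set_decode b \<or> item g E \<in> set_decode b"
    and "item (list_encode [5, f, g]) E \<in> set_decode b \<Longrightarrow>
      item f E \<in> set_decode b \<and> item g E \<in> set_decode b"
    and "item (list_encode [7, x, f]) E \<in> set_decode b \<Longrightarrow>
      item f (item (list_encode [7, x, f]) E) \<in> set_decode b"
    and "item (list_encode [0, x]) E \<in> set_decode b \<Longrightarrow>
      \<exists>y f D. E = item (list_encode [7, y, f]) D \<and>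
        (x = y \<and> E \<in> set_decode b \<or> x \<noteq> y \<and> item (list_encode [0, x]) D \<in> set_decode b)"
  by (fact assms[unfolded local_ok_def, THEN conjunct1, rule_format]
    assms[unfolded local_ok_def, THEN conjunct2, THEN conjunct1, rule_format]
    assms[unfolded local_ok_def, THEN conjunct2, THEN conjunct2, THEN conjunct1, rule_format]
    assms[unfolded local_ok_def, THEN conjunct2, THEN conjunct2, THEN conjunct2, THEN conjunct1, rule_format]
    assms[unfolded local_ok_def, THEN conjunct2, THEN conjunct2, THEN conjunct2, THEN conjunct2, THEN conjunct1, rule_format]
    assms[unfolded local_ok_def, THEN conjunct2, THEN conjunct2, THEN conjunct2, THEN conjunct2, THEN conjunct2, THEN conjunct1, rule_format]
    assms[unfolded local_ok_def, THEN conjunct2, THEN conjunct2, THEN conjunct2, THEN conjunct2, THEN conjunct2, THEN conjunct2, THEN conjunct1, rule_format]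
    assms[unfolded local_ok_def, THEN conjunct2, THEN conjunct2, THEN conjunct2, THEN conjunct2, THEN conjunct2, THEN conjunct2, THEN conjunct2, THEN conjunct1, rule_format]
    assms[unfolded local_ok_def, THEN conjunct2, THEN conjunct2, THEN conjunct2, THEN conjunct2, THEN conjunct2, THEN conjunct2, THEN conjunct2, THEN conjunct2, THEN conjunct1, rule_format]
    assms[unfolded local_ok_def, THEN conjunct2, THEN conjunct2, THEN conjunct2, THEN conjunct2, THEN conjunct2, THEN conjunct2, THEN conjunct2, THEN conjunct2, THEN conjunct2, rule_format])+

text \<open>Parametric in the relation, so that the global and the class successor share all lemmas.
  Start, edge and end tests are what an automaton reading along a chain can perform.\<close>

definition tied ::
  "(nat \<Rightarrow> bool) \<Rightarrow> (nat \<Rightarrow> nat \<Rightarrow> bool) \<Rightarrow> (nat \<Rightarrow> bool) \<Rightarrow>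
   nat set \<Rightarrow> (nat \<Rightarrow> nat \<Rightarrow> bool) \<Rightarrow> (nat \<Rightarrow> nat) \<Rightarrow> bool" where
  "tied I J Z K R lab \<longleftrightarrow> (\<forall>i\<in>K. (\<nexists>j. R j i) \<longrightarrow> I (lab i)) \<and>
     (\<forall>i j. R i j \<longrightarrow> J (lab i) (lab j)) \<and> (\<forall>i\<in>K. (\<nexists>j. R i j) \<longrightarrow> Z (lab i))"

abbreviation global_tied :: "nat set \<Rightarrow> (nat \<Rightarrow> nat \<Rightarrow> bool) \<Rightarrow> (nat \<Rightarrow> nat) \<Rightarrow> bool" where
  "global_tied \<equiv> tied (starts 2 3) (links 0 2 3 4) (ends 0 4)"

abbreviation class_tied :: "nat set \<Rightarrow> (nat \<Rightarrow> nat \<Rightarrow> bool) \<Rightarrow> (nat \<Rightarrow> nat) \<Rightarrow> bool" where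
  "class_tied \<equiv> tied (starts 3 5) (links 1 3 5 6) (ends 1 6)"

definition global_succ :: "('a, 'd) data_word \<Rightarrow> nat \<Rightarrow> nat \<Rightarrow> bool" where
  "global_succ w i j \<longleftrightarrow> j \<in> positions w \<and> j = Suc i"

definition consistent :: "('a \<Rightarrow> nat) \<Rightarrow> nat \<Rightarrow> ('a, 'd) data_word \<Rightarrow> (nat \<Rightarrow> nat) \<Rightarrow> bool" where
  "consistent c n w lab \<longleftrightarrow> 0 \<in> positions w \<and> item n 0 \<in> set_decode (lab 0) \<and>
     (\<forall>i\<in>positions w. local_ok (c (letter w i)) (of_bool (P_at w i)) (of_bool (S_at w i)) (lab i)) \<and>
     global_tied (positions w) (global_succ w) lab \<and> class_tied (positions w) (class_succ w) lab"

lemma positions_downward: "j \<in> positions w \<Longrightarrow> i \<le> j \<Longrightarrow> i \<in> positions w"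
  by (cases w) auto

lemma class_pred_iff: "class_pred w i j \<longleftrightarrow> class_succ w j i"
  unfolding class_pred_def class_succ_def by auto

lemma step_simps:
  "step XG w i j \<longleftrightarrow> global_succ w i j"
  "i \<in> positions w \<Longrightarrow> step YG w i j \<longleftrightarrow> global_succ w j i"
  "step XC w i j \<longleftrightarrow> class_succ w i j"
  "step YC w i j \<longleftrightarrow> class_succ w j i"
  by (auto simp: global_succ_def class_pred_iff intro: positions_downward)

lemma global_pred_exists: "i \<in> positions w \<Longrightarrow> (\<exists>j. global_succ w j i) \<longleftrightarrow> i \<noteq> 0"
  by (cases i) (auto simp: global_succ_def)

lemma global_succ_exists: "(\<exists>j. global_succ w i j) \<longleftrightarrow> Suc i \<in> positions w"
  by (auto simp: global_succ_def)

lemma global_succ_positions: "global_succ w i j \<Longrightarrow> i \<in> positions w \<and> j \<in> positions w"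
  by (auto simp: global_succ_def intro: positions_downward)

lemma class_succ_positions: "class_succ w i j \<Longrightarrow> i \<in> positions w \<and> j \<in> positions w"
  by (simp add: class_succ_def)

section \<open>Consistent labellings and satisfaction\<close>

context
  fixes c :: "'a \<Rightarrow> nat" and w :: "('a, 'd) data_word" and lab :: "nat \<Rightarrow> nat"
begin

definition labelled :: "'a formula list \<Rightarrow> nat set" where
  "labelled xs = {i \<in> positions w. item_code c xs \<in> set_decode (lab i)}"

text \<open>
  Interpreting a bound variable by the set of positions labelled with its \<open>\<nu>\<close>-formula makes this set a
  postfixpoint, which coinduction puts below the greatest fixpoint.
\<close>

primrec label_env :: "'a formula list \<Rightarrow> nat \<Rightarrow> nat set" where
  "label_env [] = (\<lambda>_. {})"
| "label_env (\<psi> # E) =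
    (case \<psi> of Nu x \<chi> \<Rightarrow> (label_env E)(x := labelled (\<psi> # E)) | _ \<Rightarrow> label_env E)"

lemma tied_mod_succ:
  assumes "tied (starts Y F) (links X Y F L) (ends X L) (positions w) R lab" "i \<in> positions w"
    "item (list_encode [3, X, f]) E \<in> set_decode (lab i)"
  shows "\<exists>j. R i j \<and> item f E \<in> set_decode (lab j)"
  using assms unfolding tied_def links_def ends_def no_mod_def mod_step_def by blast

lemma tied_mod_pred:
  assumes "tied (starts Y F) (links X Y F L) (ends X L) (positions w) R lab" "i \<in> positions w"
    "item (list_encode [3, Y, f]) E \<in> set_decode (lab i)"
  shows "\<exists>j. R j i \<and> item f E \<in> set_decode (lab j)"
  using assms unfolding tied_def links_def starts_def no_mod_def mod_step_def by blast

lemma tied_atom: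
  assumes "tied (starts Y F) (links X Y F L) (ends X L) (positions w) R lab" "i \<in> positions w"
  shows "has_atom 1 F (lab i) \<Longrightarrow> \<nexists>j. R j i" "has_atom 1 L (lab i) \<Longrightarrow> \<nexists>j. R i j"
    "has_atom 2 F (lab i) \<Longrightarrow> \<exists>j. R j i" "has_atom 2 L (lab i) \<Longrightarrow> \<exists>j. R i j"
  using assms unfolding tied_def links_def ends_def starts_def by blast+

text \<open>This is soundness, for an arbitrary consistent labelling without any size bound. The
  stack has to be arbitrary because the fixpoint case uses the induction hypothesis for the enlarged
  stack.\<close>

lemma labelled_subset_sem:
  assumes cons: "consistent c n w lab" and inj: "inj c" and "nu_fragment \<psi>"
  shows "labelled (\<psi> # E) \<subseteq> sem w \<psi> (label_env E)"
  using assms(3)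
proof (induction \<psi> arbitrary: E)
  have loc: "local_ok (c (letter w i)) (of_bool (P_at w i)) (of_bool (S_at w i)) (lab i)"
    if "i \<in> labelled xs" for i xs
    using that cons by (simp add: consistent_def labelled_def)
  have g: "global_tied (positions w) (global_succ w) lab"
    and cl: "class_tied (positions w) (class_succ w) lab"
    using cons by (simp_all add: consistent_def)
{
  case (Var x)
  show ?case
  \<comment> \<open>A variable is resolved by popping one entry at a time, hence an inner induction
    over the stack. With the empty stack no position is labelled, since 0 is not the code of an
    item.\<close>
  proof (induction E)
    case Nil
    then show ?case using local_okD(10)[OF loc[of _ "[Var x]"]] by (fastforce simp: labelled_def)
  next
    case (Cons \<chi> E)
    show ?case
    proof
      fix i assume i: "i \<in> labelled (Var x # \<chi> # E)"
      then have "item (list_encode [0, x]) (item_code c (\<chi> # E)) \<in> set_decode (lab i)"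
        by (simp add: labelled_def)
      then obtain y f D where D: "item_code c (\<chi> # E) = item (list_encode [7, y, f]) D"
        "x = y \<and> item_code c (\<chi> # E) \<in> set_decode (lab i) \<or>
         x \<noteq> y \<and> item (list_encode [0, x]) D \<in> set_decode (lab i)"
        using local_okD(10)[OF loc[OF i]] by blast
      then obtain \<theta> where "\<chi> = Nu y \<theta>"
        by (cases \<chi>) (auto simp: list_encode_eq)
      with D i Cons show "i \<in> sem w (Var x) (label_env (\<chi> # E))"
        by (auto simp: labelled_def)
    qed
  qed
next
  case (Atom A)
  show ?case
  proof
    fix i assume i: "i \<in> labelled (Atom A # E)"
    then have pos: "i \<in> positions w"
      and mem: "item (list_encode [1, atom_code c A]) (item_code c E) \<in> set_decode (lab i)"
      by (auto simp: labelled_def)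
    have has: "has_atom 1 k (lab i)" if "atom_code c A = list_encode [k]" for k
      using mem that unfolding has_atom_def by metis
    have "has_atom 1 3 (lab i) \<Longrightarrow> i = 0" "has_atom 1 4 (lab i) \<Longrightarrow> Suc i \<notin> positions w"
      using tied_atom(1,2)[OF g pos] pos by (simp_all add: global_pred_exists global_succ_exists)
    moreover have "has_atom 1 5 (lab i) \<Longrightarrow> \<nexists>j. class_pred w i j"
      "has_atom 1 6 (lab i) \<Longrightarrow> \<nexists>j. class_succ w i j"
      using tied_atom(1,2)[OF cl pos] unfolding class_pred_iff by blast+
    moreover have "has_atom 1 1 (lab i) \<Longrightarrow> S_at w i" "has_atom 1 2 (lab i) \<Longrightarrow> P_at w i"
      using local_okD(3-6)[OF loc[OF i]] by (simp_all del: One_nat_def)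
    moreover have "letter w i = a" if "A = Letter a" for a
      using that mem local_okD(1)[OF loc[OF i]] inj by (metis atom_code.simps(1) injD)
    ultimately have "atom_holds w i A"
      using has by (cases A) (simp_all del: One_nat_def)
    with pos show "i \<in> sem w (Atom A) (label_env E)" by simp
  qed
next
  case (NegAtom A)
  show ?case
  proof
    fix i assume i: "i \<in> labelled (NegAtom A # E)"
    then have pos: "i \<in> positions w"
      and mem: "item (list_encode [2, atom_code c A]) (item_code c E) \<in> set_decode (lab i)"
      by (auto simp: labelled_def)
    have has: "has_atom 2 k (lab i)" if "atom_code c A = list_encode [k]" for k
      using mem that unfolding has_atom_def by metis
    have "has_atom 2 3 (lab i) \<Longrightarrow> i \<noteq> 0" "has_atom 2 4 (lab i) \<Longrightarrow> Suc i \<in> positions w"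
      using tied_atom(3,4)[OF g pos] pos by (simp_all add: global_pred_exists global_succ_exists)
    moreover have "has_atom 2 5 (lab i) \<Longrightarrow> \<exists>j. class_pred w i j"
      "has_atom 2 6 (lab i) \<Longrightarrow> \<exists>j. class_succ w i j"
      using tied_atom(3,4)[OF cl pos] unfolding class_pred_iff by blast+
    moreover have "has_atom 2 1 (lab i) \<Longrightarrow> \<not> S_at w i" "has_atom 2 2 (lab i) \<Longrightarrow> \<not> P_at w i"
      using local_okD(3-6)[OF loc[OF i]] by (simp_all del: One_nat_def)
    moreover have "letter w i \<noteq> a" if "A = Letter a" for a
      using that mem local_okD(2)[OF loc[OF i]] by auto
    ultimately have "\<not> atom_holds w i A"
      using has by (cases A) (simp_all del: One_nat_def)
    with pos show "i \<in> sem w (NegAtom A) (label_env E)" by simp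
  qed
next
  case (Mod m \<psi>)
  show ?case
  proof
    fix i assume i: "i \<in> labelled (Mod m \<psi> # E)"
    then have pos: "i \<in> positions w"
      and mem: "item (list_encode [3, modality_code m, formula_code c \<psi>]) (item_code c E)
        \<in> set_decode (lab i)"
      by (auto simp: labelled_def)
    have "\<exists>j. step m w i j \<and> item (formula_code c \<psi>) (item_code c E) \<in> set_decode (lab j)"
      using mem tied_mod_succ[OF g pos] tied_mod_pred[OF g pos] tied_mod_succ[OF cl pos]
        tied_mod_pred[OF cl pos]
      by (cases m) (auto simp: step_simps pos simp del: One_nat_def step.simps)
    moreover have "j \<in> positions w" if "step m w i j" for j
      using that pos by (cases m) (auto simp: class_succ_def class_pred_def)
    ultimately show "i \<in> sem w (Mod m \<psi>) (label_env E)"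
      using pos Mod by (fastforce simp: labelled_def)
  qed
next
  case (Or \<psi> \<chi>)
  have "labelled (Or \<psi> \<chi> # E) \<subseteq> labelled (\<psi> # E) \<union> labelled (\<chi> # E)"
    using local_okD(7)[OF loc] by (fastforce simp: labelled_def)
  with Or show ?case by fastforce
next
  case (And \<psi> \<chi>)
  have "labelled (And \<psi> \<chi> # E) \<subseteq> labelled (\<psi> # E) \<inter> labelled (\<chi> # E)"
    using local_okD(8)[OF loc] by (fastforce simp: labelled_def)
  with And show ?case by fastforce
next
  case (Mu x \<psi>)
  then show ?case by simp
next
  case (Nu x \<psi>)
  have "labelled (Nu x \<psi> # E) \<subseteq> labelled (\<psi> # Nu x \<psi> # E)"
    using local_okD(9)[OF loc] by (fastforce simp: labelled_def)
  also have "\<dots> \<subseteq> sem w \<psi> ((label_env E)(x := labelled (Nu x \<psi> # E)))"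
    using Nu.IH[of "Nu x \<psi> # E"] Nu.prems by (simp add: fun_upd_def)
  finally show ?case by (simp add: gfp_upperbound)
}
qed

lemma consistent_imp_satisfies:
  assumes "consistent c (formula_code c \<phi>) w lab" "inj c" "nu_fragment \<phi>"
  shows "satisfies w \<phi>"
  using labelled_subset_sem[OF assms, of "[]"] assms(1)
  by (auto simp: satisfies_def consistent_def labelled_def)

end

section \<open>A bound on codes, and the labelling by all true obligations\<close>

definition item_bound :: "nat \<Rightarrow> nat" where
  "item_bound n = rec_nat 0 (\<lambda>_ r. item n r) (Suc n)"

definition label_bound :: "nat \<Rightarrow> nat" where
  "label_bound n = 2 ^ Suc (item_bound n)"

lemma triangle_mono: "m \<le> n \<Longrightarrow> triangle m \<le> triangle n"
  unfolding triangle_def by (intro div_le_mono mult_le_mono) auto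

lemma prod_encode_mono: "a \<le> a' \<Longrightarrow> b \<le> b' \<Longrightarrow> prod_encode (a, b) \<le> prod_encode (a', b')"
  unfolding prod_encode_def by (auto intro!: add_mono triangle_mono)

text \<open>The recursion computes the code of the list of \<open>m\<close> copies of
  \<open>n\<close>, and list codes grow with the entries and with the length.\<close>

lemma list_encode_le_rec:
  assumes "\<forall>x\<in>set xs. x \<le> n" "length xs \<le> m"
  shows "list_encode xs \<le> rec_nat 0 (\<lambda>_ r. item n r) m"
  using assms
proof (induction xs arbitrary: m)
  case (Cons x xs)
  then show ?case by (cases m) (auto simp: list_encode.simps intro!: prod_encode_mono)
qed (simp add: list_encode.simps)

text \<open>Distinct entries from \<open>{..n}\<close> number at most \<open>Suc n\<close>; this is
  the origin of the recursion depth in \<open>item_bound\<close>.\<close>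

lemma sorted_list_encode_le:
  assumes "sorted_wrt (<) xs" "\<forall>x\<in>set xs. x \<le> n"
  shows "list_encode xs \<le> item_bound n"
proof -
  have "distinct xs" using assms(1) strict_sorted_iff by blast
  then have "length xs = card (set xs)" by (simp add: distinct_card)
  also have "\<dots> \<le> card {..n}" using assms(2) by (intro card_mono) auto
  finally show ?thesis unfolding item_bound_def using assms(2) by (intro list_encode_le_rec) auto
qed

lemma set_encode_le:
  assumes "A \<subseteq> {..n}"
  shows "set_encode A \<le> 2 ^ Suc n"
proof -
  have "set_encode A \<le> sum ((^) 2) {0..<Suc n}"
    unfolding set_encode_def using assms by (intro sum_mono2) auto
  then show ?thesis by (simp only: sum_power2)
qed

lemma sem_mono:
  assumes "\<And>x. V x \<subseteq> V' x"
  shows "sem w \<phi> V \<subseteq> sem w \<phi> V'"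
  using assms
proof (induction \<phi> arbitrary: V V')
  case (Mod m \<phi>)
  have "sem w \<phi> V \<subseteq> sem w \<phi> V'" using Mod by simp
  then show ?case by auto
next
  case (Or \<phi> \<psi>)
  have "sem w \<phi> V \<subseteq> sem w \<phi> V'" "sem w \<psi> V \<subseteq> sem w \<psi> V'" using Or by simp_all
  then show ?case by auto
next
  case (And \<phi> \<psi>)
  have "sem w \<phi> V \<subseteq> sem w \<phi> V'" "sem w \<psi> V \<subseteq> sem w \<psi> V'" using And by simp_all
  then show ?case by auto
next
  case (Mu x \<phi>)
  then show ?case unfolding sem.simps by (intro lfp_mono Mu.IH) auto
next
  case (Nu x \<phi>)
  then show ?case unfolding sem.simps by (intro gfp_mono Nu.IH) auto
qed auto

lemma sem_Nu_unfold: "sem w (Nu x \<phi>) V = sem w \<phi> (V(x := sem w (Nu x \<phi>) V))"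
proof -
  have "mono (\<lambda>X. sem w \<phi> (V(x := X)))"
    by (intro monoI sem_mono) auto
  from gfp_unfold[OF this] show ?thesis by simp
qed

lemma sem_subset_positions: "sem w \<phi> V \<subseteq> positions w"
proof (induction \<phi> arbitrary: V)
  case (Mu x \<phi>)
  then show ?case by (simp add: lfp_lowerbound)
next
  case (Nu x \<phi>)
  then show ?case using sem_Nu_unfold[of w x \<phi> V] by metis
qed auto

text \<open>Strictness makes subformulas have smaller codes, which keeps stacks sorted when a
  fixpoint is unfolded. It also bounds the quantifiers when the label conditions are
  decided.\<close>

lemma less_list_encode: "x \<in> set xs \<Longrightarrow> x < list_encode xs"
proof (induction xs)
  case (Cons y xs)
  then show ?case
    using le_prod_encode_1[of y "list_encode xs"] le_prod_encode_2[of "list_encode xs" y]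
    by (auto simp: list_encode.simps)
qed simp

lemma subformula_code_less:
  "formula_code c \<psi> < formula_code c (Mod m \<psi>)"
  "formula_code c \<psi> < formula_code c (Or \<psi> \<chi>)" "formula_code c \<chi> < formula_code c (Or \<psi> \<chi>)"
  "formula_code c \<psi> < formula_code c (And \<psi> \<chi>)" "formula_code c \<chi> < formula_code c (And \<psi> \<chi>)"
  "formula_code c \<psi> < formula_code c (Nu x \<psi>)"
  by (simp_all add: less_list_encode)

text \<open>Label conditions speak of numbers, the semantics of formulas. These inversions recover
  the outermost constructor from a code, with no assumption on \<open>c\<close>.\<close>

lemma formula_code_eq:
  "formula_code c \<psi> = list_encode [0, x] \<longleftrightarrow> \<psi> = Var x"
  "formula_code c \<psi> = list_encode [1, a] \<longleftrightarrow> (\<exists>A. \<psi> = Atom A \<and> atom_code c A = a)"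
  "formula_code c \<psi> = list_encode [2, a] \<longleftrightarrow> (\<exists>A. \<psi> = NegAtom A \<and> atom_code c A = a)"
  "formula_code c \<psi> = list_encode [3, k, f] \<longleftrightarrow>
     (\<exists>m \<chi>. \<psi> = Mod m \<chi> \<and> modality_code m = k \<and> formula_code c \<chi> = f)"
  "formula_code c \<psi> = list_encode [4, f, g] \<longleftrightarrow>
     (\<exists>\<chi> \<theta>. \<psi> = Or \<chi> \<theta> \<and> formula_code c \<chi> = f \<and> formula_code c \<theta> = g)"
  "formula_code c \<psi> = list_encode [5, f, g] \<longleftrightarrow>
     (\<exists>\<chi> \<theta>. \<psi> = And \<chi> \<theta> \<and> formula_code c \<chi> = f \<and> formula_code c \<theta> = g)"
  "formula_code c \<psi> = list_encode [7, x, f] \<longleftrightarrow> (\<exists>\<chi>. \<psi> = Nu x \<chi> \<and> formula_code c \<chi> = f)"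
  by (cases \<psi>; auto simp: list_encode_eq)+

lemma atom_code_eq:
  "atom_code c A = list_encode [0, l] \<longleftrightarrow> (\<exists>a. A = Letter a \<and> c a = l)"
  "atom_code c A = list_encode [1] \<longleftrightarrow> A = S_mark"
  "atom_code c A = list_encode [2] \<longleftrightarrow> A = P_mark"
  "atom_code c A = list_encode [3] \<longleftrightarrow> A = FirstG"
  "atom_code c A = list_encode [4] \<longleftrightarrow> A = LastG"
  "atom_code c A = list_encode [5] \<longleftrightarrow> A = FirstC"
  "atom_code c A = list_encode [6] \<longleftrightarrow> A = LastC"
  by (cases A; auto simp: list_encode_eq)+

lemma modality_code_eq:
  "modality_code m = 0 \<longleftrightarrow> m = XG" "modality_code m = 1 \<longleftrightarrow> m = XC"
  "modality_code m = 2 \<longleftrightarrow> m = YG" "modality_code m = 3 \<longleftrightarrow> m = YC"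
  by (cases m; simp)+

text \<open>The counterpart of \<open>label_env\<close>, with the true value of a fixpoint in place
  of the set of positions labelled with it.\<close>

primrec sem_env :: "('a, 'd) data_word \<Rightarrow> 'a formula list \<Rightarrow> nat \<Rightarrow> nat set" where
  "sem_env w [] = (\<lambda>_. {})"
| "sem_env w (\<psi> # E) =
    (case \<psi> of Nu x \<chi> \<Rightarrow> (sem_env w E)(x := sem w \<psi> (sem_env w E)) | _ \<Rightarrow> sem_env w E)"

context
  fixes c :: "'a \<Rightarrow> nat" and n :: nat and w :: "('a, 'd) data_word"
  assumes inj: "inj c"
begin

text \<open>
  Pushed formulas have smaller codes than the top of the stack, so codes increase along an item. This
  bounds both the length and the entries of the items that occur.
\<close>

definition valid :: "'a formula list \<Rightarrow> bool" where
  "valid xs \<longleftrightarrow> sorted_wrt (<) (map (formula_code c) xs) \<and> (\<forall>\<psi>\<in>set xs. formula_code c \<psi> \<le> n) \<and>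
     (\<forall>\<psi>\<in>set (tl xs). \<exists>x \<chi>. \<psi> = Nu x \<chi>)"

definition true_items :: "nat \<Rightarrow> nat set" where
  "true_items i = {item_code c (\<psi> # E) |\<psi> E. valid (\<psi> # E) \<and> i \<in> sem w \<psi> (sem_env w E)}"

definition true_label :: "nat \<Rightarrow> nat" where
  "true_label i = set_encode (true_items i)"

lemma true_items_bounded: "true_items i \<subseteq> {..item_bound n}"
  unfolding true_items_def valid_def item_code_def by (auto intro!: sorted_list_encode_le)

lemma true_label_le: "true_label i \<le> label_bound n"
  unfolding true_label_def label_bound_def by (intro set_encode_le true_items_bounded)

lemma mem_true_label:
  "item f E \<in> set_decode (true_label i) \<longleftrightarrow>
    (\<exists>\<psi> D. formula_code c \<psi> = f \<and> item_code c D = E \<and> valid (\<psi> # D) \<and> i \<in> sem w \<psi> (sem_env w D))"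
proof -
  have "finite (true_items i)"
    using true_items_bounded finite_subset by blast
  then show ?thesis unfolding true_label_def by (auto simp: true_items_def)
qed

lemma item_code_inj: "item_code c xs = item_code c ys \<longleftrightarrow> xs = ys"
  unfolding item_code_def list_encode_eq using formula_code_inj[OF inj] by (simp add: inj_map_eq_map)

lemma mem_true_label_code:
  "item (formula_code c \<psi>) (item_code c D) \<in> set_decode (true_label i) \<longleftrightarrow>
    valid (\<psi> # D) \<and> i \<in> sem w \<psi> (sem_env w D)"
  unfolding mem_true_label using formula_code_inj[OF inj] by (auto simp: item_code_inj inj_eq)

lemma valid_replace:
  "valid (\<psi> # E) \<Longrightarrow> formula_code c \<chi> < formula_code c \<psi> \<Longrightarrow> valid (\<chi> # E)"
  unfolding valid_def by auto

lemma valid_push: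
  "valid (Nu x \<chi> # E) \<Longrightarrow> valid (\<chi> # Nu x \<chi> # E)"
  using subformula_code_less(6)[of c \<chi> x] unfolding valid_def by (auto simp del: formula_code.simps)

lemma valid_pop: "valid (\<psi> # \<chi> # E) \<Longrightarrow> valid (\<chi> # E) \<and> valid (\<psi> # E)"
  unfolding valid_def by auto

lemma true_label_has_atom:
  "has_atom 1 k (true_label i) \<Longrightarrow> \<exists>A. atom_code c A = list_encode [k] \<and> i \<in> positions w \<and> atom_holds w i A"
  "has_atom 2 k (true_label i) \<Longrightarrow> \<exists>A. atom_code c A = list_encode [k] \<and> i \<in> positions w \<and> \<not> atom_holds w i A"
  unfolding has_atom_def mem_true_label formula_code_eq by fastforce+

lemma true_label_mod:
  assumes "item (list_encode [3, k, f]) E \<in> set_decode (true_label i)"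
  shows "\<exists>m j. modality_code m = k \<and> i \<in> positions w \<and> step m w i j \<and> item f E \<in> set_decode (true_label j)"
proof -
  obtain m \<chi> D where *: "modality_code m = k" "formula_code c \<chi> = f" "item_code c D = E"
    "valid (Mod m \<chi> # D)" "i \<in> sem w (Mod m \<chi>) (sem_env w D)"
    using assms unfolding mem_true_label formula_code_eq by blast
  then obtain j where "i \<in> positions w" "step m w i j" "j \<in> sem w \<chi> (sem_env w D)" by auto
  moreover have "valid (\<chi> # D)" using valid_replace[OF *(4)] subformula_code_less(1) by blast
  ultimately show ?thesis using * mem_true_label_code by blast
qed

text \<open>Truth is preserved by each rule, and so is validity: components have smaller codes, an
  unfolded fixpoint has a larger code than its body, and popping leaves a sublist of a sorted
  list.\<close>

lemma true_label_local_ok: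
  assumes "i \<in> positions w"
  shows "local_ok (c (letter w i)) (of_bool (P_at w i)) (of_bool (S_at w i)) (true_label i)"
  unfolding local_ok_def
proof (intro conjI allI impI)
  fix l E assume "item (list_encode [1, list_encode [0, l]]) E \<in> set_decode (true_label i)"
  then show "l = c (letter w i)"
    unfolding mem_true_label formula_code_eq atom_code_eq by auto
next
  fix E show "item (list_encode [2, list_encode [0, c (letter w i)]]) E \<notin> set_decode (true_label i)"
    unfolding mem_true_label formula_code_eq atom_code_eq using inj by (auto simp: inj_eq)
next
  fix f g E assume "item (list_encode [4, f, g]) E \<in> set_decode (true_label i)"
  then obtain \<psi> \<chi> D where *: "formula_code c \<psi> = f" "formula_code c \<chi> = g" "item_code c D = E"
    "valid (Or \<psi> \<chi> # D)" "i \<in> sem w (Or \<psi> \<chi>) (sem_env w D)"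
    unfolding mem_true_label formula_code_eq by blast
  moreover have "valid (\<psi> # D)" "valid (\<chi> # D)" using valid_replace[OF *(4)] subformula_code_less by blast+
  ultimately show "item f E \<in> set_decode (true_label i) \<or> item g E \<in> set_decode (true_label i)"
    unfolding *(1-3)[symmetric] mem_true_label_code by simp
next
  fix f g E assume "item (list_encode [5, f, g]) E \<in> set_decode (true_label i)"
  then obtain \<psi> \<chi> D where *: "formula_code c \<psi> = f" "formula_code c \<chi> = g" "item_code c D = E"
    "valid (And \<psi> \<chi> # D)" "i \<in> sem w (And \<psi> \<chi>) (sem_env w D)"
    unfolding mem_true_label formula_code_eq by blast
  moreover have "valid (\<psi> # D)" "valid (\<chi> # D)" using valid_replace[OF *(4)] subformula_code_less by blast+
  ultimately show "item f E \<in> set_decode (true_label i)" "item g E \<in> set_decode (true_label i)"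
    unfolding *(1-3)[symmetric] mem_true_label_code by simp_all
next
  fix x f E assume "item (list_encode [7, x, f]) E \<in> set_decode (true_label i)"
  then obtain \<psi> D where *: "formula_code c \<psi> = f" "item_code c D = E"
    "valid (Nu x \<psi> # D)" "i \<in> sem w (Nu x \<psi>) (sem_env w D)"
    unfolding mem_true_label formula_code_eq by blast
  \<comment> \<open>The updated valuation is \<open>sem_env\<close> of the stack with
    \<open>Nu x \<psi>\<close> pushed, so unfolding the fixpoint is exactly a push.\<close>
  have "i \<in> sem w \<psi> ((sem_env w D)(x := sem w (Nu x \<psi>) (sem_env w D)))"
    using *(4) sem_Nu_unfold by blast
  then have "item (formula_code c \<psi>) (item_code c (Nu x \<psi> # D)) \<in> set_decode (true_label i)"
    unfolding mem_true_label_code using valid_push[OF *(3)] by (simp del: sem.simps)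
  then show "item f (item (list_encode [7, x, f]) E) \<in> set_decode (true_label i)"
    unfolding *(1,2)[symmetric] by simp
next
  fix x E assume "item (list_encode [0, x]) E \<in> set_decode (true_label i)"
  then obtain D where D: "item_code c D = E" "valid (Var x # D)" "i \<in> sem_env w D x"
    unfolding mem_true_label formula_code_eq by auto
  \<comment> \<open>Under the empty stack every variable denotes the empty set.\<close>
  then have "D \<noteq> []" by auto
  then obtain \<theta> D' where D': "D = \<theta> # D'" by (cases D) simp_all
  have "\<exists>y \<psi>. \<theta> = Nu y \<psi>" using D(2) D' by (simp add: valid_def)
  then obtain y \<psi> where y: "\<theta> = Nu y \<psi>" by blast
  have v: "valid (\<theta> # D')" "valid (Var x # D')" using D(2) valid_pop D' by blast+
  have "x = y \<and> item (formula_code c \<theta>) (item_code c D') \<in> set_decode (true_label i) \<or>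
    x \<noteq> y \<and> item (formula_code c (Var x)) (item_code c D') \<in> set_decode (true_label i)"
  proof (cases "x = y")
    case True
    then show ?thesis
      unfolding mem_true_label_code using v(1) D(3) D' y by (simp del: sem.simps)
  next
    case False
    then show ?thesis
      unfolding mem_true_label_code using v(2) D(3) D' y assms by simp
  qed
  then have "x = y \<and> E \<in> set_decode (true_label i) \<or>
      x \<noteq> y \<and> item (list_encode [0, x]) (item_code c D') \<in> set_decode (true_label i)"
    using D(1) D' by simp
  moreover have "E = item (list_encode [7, y, formula_code c \<psi>]) (item_code c D')"
    using D(1) D' y by simp
  ultimately show "\<exists>y f D. E = item (list_encode [7, y, f]) D \<and>
      (x = y \<and> E \<in> set_decode (true_label i) \<or>
       x \<noteq> y \<and> item (list_encode [0, x]) D \<in> set_decode (true_label i))"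
    by blast
next
  show "of_bool (S_at w i) = 1" if "has_atom 1 1 (true_label i)"
    using true_label_has_atom(1)[OF that] unfolding atom_code_eq by auto
  show "of_bool (S_at w i) = 0" if "has_atom 2 1 (true_label i)"
    using true_label_has_atom(2)[OF that] unfolding atom_code_eq by auto
  show "of_bool (P_at w i) = 1" if "has_atom 1 2 (true_label i)"
    using true_label_has_atom(1)[OF that] unfolding atom_code_eq by auto
  show "of_bool (P_at w i) = 0" if "has_atom 2 2 (true_label i)"
    using true_label_has_atom(2)[OF that] unfolding atom_code_eq by auto
qed

text \<open>Functionality of \<open>R\<close> in both directions matters on edges: the position
  witnessing a true modality must be the very neighbour that the edge names.\<close>

lemma true_label_tied:
  assumes R: "\<And>i j. R i j \<Longrightarrow> i \<in> positions w \<and> j \<in> positions w"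
    and X: "\<And>m i j. modality_code m = X \<Longrightarrow> i \<in> positions w \<Longrightarrow> step m w i j \<longleftrightarrow> R i j"
    and Y: "\<And>m i j. modality_code m = Y \<Longrightarrow> i \<in> positions w \<Longrightarrow> step m w i j \<longleftrightarrow> R j i"
    and F: "\<And>A i. atom_code c A = list_encode [F] \<Longrightarrow> i \<in> positions w \<Longrightarrow> atom_holds w i A \<longleftrightarrow> (\<nexists>j. R j i)"
    and L: "\<And>A i. atom_code c A = list_encode [L] \<Longrightarrow> i \<in> positions w \<Longrightarrow> atom_holds w i A \<longleftrightarrow> (\<nexists>j. R i j)"
    and X1: "\<And>i j k. R i j \<Longrightarrow> R i k \<Longrightarrow> j = k" and Y1: "\<And>i j k. R j i \<Longrightarrow> R k i \<Longrightarrow> j = k"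
  shows "tied (starts Y F) (links X Y F L) (ends X L) (positions w) R true_label"
proof -
  have "mod_step X (true_label i) (true_label j)" if "R i j" for i j
    unfolding mod_step_def using true_label_mod X X1 that by blast
  moreover have "mod_step Y (true_label j) (true_label i)" if "R i j" for i j
    unfolding mod_step_def using true_label_mod Y Y1 that by blast
  moreover have "no_mod X (true_label i)" if "\<nexists>j. R i j" for i
    unfolding no_mod_def using true_label_mod X that by blast
  moreover have "no_mod Y (true_label i)" if "\<nexists>j. R j i" for i
    unfolding no_mod_def using true_label_mod Y that by blast
  moreover have "\<not> has_atom 1 L (true_label i)" "\<not> has_atom 1 F (true_label j)" if "R i j" for i j
    using true_label_has_atom(1) F L that R by blast+
  moreover have "\<not> has_atom 2 L (true_label i)" if "\<nexists>j. R i j" for i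
    using true_label_has_atom(2) L that by blast
  moreover have "\<not> has_atom 2 F (true_label i)" if "\<nexists>j. R j i" for i
    using true_label_has_atom(2) F that by blast
  ultimately show ?thesis
    unfolding tied_def links_def ends_def starts_def by simp
qed

lemma satisfies_imp_consistent:
  assumes "satisfies w \<phi>" "n = formula_code c \<phi>"
  shows "consistent c n w true_label"
proof -
  have "0 \<in> positions w"
    using assms(1) sem_subset_positions unfolding satisfies_def by blast
  moreover have "valid [\<phi>]" unfolding valid_def using assms(2) by simp
  moreover from this have "item n 0 \<in> set_decode (true_label 0)"
    using mem_true_label_code[of \<phi> "[]"] assms by (simp add: satisfies_def)
  moreover have "global_tied (positions w) (global_succ w) true_label"
  proof (intro true_label_tied)
    show "j = k" if "global_succ w i j" "global_succ w i k" for i j k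
      using that by (simp add: global_succ_def)
    show "j = k" if "global_succ w j i" "global_succ w k i" for i j k
      using that by (simp add: global_succ_def)
  qed (auto simp: atom_code_eq modality_code_eq step_simps global_pred_exists global_succ_exists
      global_succ_positions simp del: step.simps One_nat_def)
  moreover have "class_tied (positions w) (class_succ w) true_label"
  proof (intro true_label_tied)
    show "j = k" if "class_succ w i j" "class_succ w i k" for i j k
      using that unfolding class_succ_def by (metis linorder_neqE_nat)
    show "j = k" if "class_succ w j i" "class_succ w k i" for i j k
      using that unfolding class_succ_def by (metis linorder_neqE_nat)
  qed (auto simp: atom_code_eq modality_code_eq step_simps class_pred_iff class_succ_positions
      simp del: step.simps One_nat_def)
  ultimately show ?thesis
    using true_label_local_ok unfolding consistent_def by blast
qed

end

lemma satisfies_iff_consistent: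
  assumes "inj c" "nu_fragment \<phi>"
  shows "satisfies w \<phi> \<longleftrightarrow>
    (\<exists>lab. consistent c (formula_code c \<phi>) w lab \<and> (\<forall>i. lab i \<le> label_bound (formula_code c \<phi>)))"
  using satisfies_imp_consistent[OF assms(1) _ refl] true_label_le[OF assms(1)]
    consistent_imp_satisfies[OF _ assms(1,2)] by blast

section \<open>The automata\<close>

definition succ_in :: "nat set \<Rightarrow> nat \<Rightarrow> nat \<Rightarrow> bool" where
  "succ_in D i j \<longleftrightarrow> i \<in> D \<and> j \<in> D \<and> j = Suc i"

lemma global_succ_eq: "global_succ w = succ_in (positions w)"
  by (intro ext) (auto simp: global_succ_def succ_in_def intro: positions_downward)

text \<open>The argument \<open>p\<close> is an automaton state, that is, an optional previous
  label: 0 stands for none and \<open>Suc b'\<close> for \<open>b'\<close>.\<close>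

definition reads :: "(nat \<Rightarrow> bool) \<Rightarrow> (nat \<Rightarrow> nat \<Rightarrow> bool) \<Rightarrow> nat \<Rightarrow> nat \<Rightarrow> bool" where
  "reads I J p b \<longleftrightarrow> p = 0 \<and> I b \<or> (\<exists>b'. p = Suc b' \<and> J b' b)"

definition run :: "(nat \<Rightarrow> nat) \<Rightarrow> nat \<Rightarrow> nat" where
  "run lab i = (case i of 0 \<Rightarrow> 0 | Suc k \<Rightarrow> Suc (lab k))"

lemma run_simps [simp]: "run lab 0 = 0" "run lab (Suc k) = Suc (lab k)"
  by (simp_all add: run_def)

text \<open>Each transition leads to the successor of the letter read, so the word determines the
  run and the quantifier over runs disappears. A run agrees with \<open>run lab\<close> up to
  \<open>m\<close> only, being unconstrained beyond.\<close>

lemma ex_run_finite: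
  "(\<exists>\<rho>. \<rho> 0 = 0 \<and> (\<forall>i<m. \<rho> (Suc i) = Suc (lab i) \<and> Q i (\<rho> i)) \<and> P (\<rho> m)) \<longleftrightarrow>
    (\<forall>i<m. Q i (run lab i)) \<and> P (run lab m)" (is "?l \<longleftrightarrow> ?r")
proof
  assume ?l
  then obtain \<rho> where \<rho>: "\<rho> 0 = 0" "\<forall>i<m. \<rho> (Suc i) = Suc (lab i) \<and> Q i (\<rho> i)" "P (\<rho> m)"
    by blast
  then have "\<rho> i = run lab i" if "i \<le> m" for i
    using that by (cases i) auto
  with \<rho> show ?r by simp
next
  assume ?r
  then show ?l by (intro exI[of _ "run lab"]) simp
qed

lemma ex_run_infinite:
  "(\<exists>\<rho>. \<rho> 0 = 0 \<and> (\<forall>i. \<rho> (Suc i) = Suc (lab i) \<and> Q i (\<rho> i)) \<and> P \<rho>) \<longleftrightarrow>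
    (\<forall>i. Q i (run lab i)) \<and> P (run lab)" (is "?l \<longleftrightarrow> ?r")
proof
  assume ?l
  then obtain \<rho> where \<rho>: "\<rho> 0 = 0" "\<forall>i. \<rho> (Suc i) = Suc (lab i) \<and> Q i (\<rho> i)" "P \<rho>"
    by blast
  then have "\<rho> i = run lab i" for i
    by (cases i) auto
  then have "\<rho> = run lab" by blast
  with \<rho> show ?r by simp
next
  assume ?r
  then show ?l by (intro exI[of _ "run lab"]) simp
qed

lemma no_succ_in:
  assumes "\<And>i. Suc i \<in> D \<Longrightarrow> i \<in> D" "i \<in> D"
  shows "(\<nexists>j. succ_in D j i) \<longleftrightarrow> i = 0"
  using assms by (cases i) (auto simp: succ_in_def)

text \<open>On an initial segment \<open>run lab i\<close> carries the previous label, so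
  \<open>reads\<close> covers the start test and all edge tests. The end test stays apart, since it
  becomes the acceptance condition.\<close>

lemma tied_succ_in:
  assumes "\<And>i. Suc i \<in> D \<Longrightarrow> i \<in> D"
  shows "tied I J Z D (succ_in D) lab \<longleftrightarrow>
    (\<forall>i\<in>D. reads I J (run lab i) (lab i)) \<and> (\<forall>i\<in>D. Suc i \<notin> D \<longrightarrow> Z (lab i))"
proof -
  have "(\<forall>i\<in>D. reads I J (run lab i) (lab i)) \<longleftrightarrow>
    (0 \<in> D \<longrightarrow> I (lab 0)) \<and> (\<forall>i. Suc i \<in> D \<longrightarrow> J (lab i) (lab (Suc i)))"
    (is "?l \<longleftrightarrow> ?r")
  proof
    assume l: ?l
    then show ?r by (fastforce simp: reads_def)
  next
    assume r: ?r
    show ?l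
    proof
      fix i assume "i \<in> D"
      with r show "reads I J (run lab i) (lab i)" by (cases i) (simp_all add: reads_def)
    qed
  qed
  then show ?thesis
    using assms no_succ_in[of D] by (auto simp: tied_def succ_in_def)
qed

text \<open>Only 0 lacks a predecessor in an initial segment. Hence the demand that the first label
  contain the given formula can be put into the start test of the transducer.\<close>

lemma tied_initial:
  assumes "\<And>i. Suc i \<in> D \<Longrightarrow> i \<in> D" "0 \<in> D"
  shows "tied (\<lambda>b. I b \<and> P b) J Z D (succ_in D) lab \<longleftrightarrow> tied I J Z D (succ_in D) lab \<and> P (lab 0)"
  using assms no_succ_in[of D] by (auto simp: tied_def)

text \<open>The explicit bound on \<open>q\<close> gives the shape to which
  \<open>computable_set_encode\<close> applies. State 0 is excluded, so the empty word is
  rejected.\<close>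

definition last_states :: "nat \<Rightarrow> (nat \<Rightarrow> bool) \<Rightarrow> nat set" where
  "last_states W Z = {q. q \<le> Suc W \<and> (\<exists>b\<le>W. q = Suc b \<and> Z b)}"

text \<open>A state is the successor of the label read last, and 0 before the first one.\<close>

definition class_aut :: "nat \<Rightarrow> nat set \<Rightarrow> (nat, nat) automaton" where
  "class_aut W A = \<lparr>states = {..Suc W}, initial = {0},
     transitions = {(p, b, q). p \<le> Suc W \<and> b \<le> W \<and> q = Suc b \<and>
       reads (starts 3 5) (links 1 3 5 6) p b},
     accepting = A\<rparr>"

text \<open>The argument \<open>n\<close> is the code of the formula, and \<open>item n 0\<close> is
  its obligation under the empty stack. All states are Buchi states, because the transitions already
  enforce every condition on an infinite word.\<close>

definition base_aut :: "('a \<Rightarrow> nat) \<Rightarrow> nat \<Rightarrow> nat \<Rightarrow> (nat, 'a marked, nat) transducer" where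
  "base_aut c n W = \<lparr>t_states = {..Suc W}, t_initial = {0},
     t_transitions = {(p, (a, m, s), b, q). p \<le> Suc W \<and> b \<le> W \<and> q = Suc b \<and>
       local_ok (c a) (of_bool m) (of_bool s) b \<and>
       reads (\<lambda>b. starts 2 3 b \<and> item n 0 \<in> set_decode b) (links 0 2 3 4) p b},
     t_final = last_states W (ends 0 4), t_buchi = {..Suc W}\<rparr>"

definition formula_aut :: "('a \<Rightarrow> nat) \<Rightarrow> nat \<Rightarrow> 'a data_omega_automaton" where
  "formula_aut c n = \<lparr>base = base_aut c n (label_bound n), alphabet = {..label_bound n},
     class_automaton = class_aut (label_bound n) (last_states (label_bound n) (ends 1 6)),
     class_buchi = class_aut (label_bound n) {..Suc (label_bound n)}\<rparr>"

lemma wf_formula_aut: "wf_data_omega_automaton (formula_aut c n)"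
  unfolding wf_data_omega_automaton_def wf_transducer_def wf_automaton_def formula_aut_def
    base_aut_def class_aut_def last_states_def
  by auto

lemma run_le: "(\<forall>i<m. lab i \<le> W) \<Longrightarrow> i \<le> m \<Longrightarrow> run lab i \<le> Suc W"
  by (cases i) auto

lemma accepts_class_aut:
  assumes "u \<noteq> []"
  shows "accepts (class_aut W (last_states W (ends 1 6))) u \<longleftrightarrow>
    (\<forall>i<length u. u ! i \<le> W) \<and> class_tied {..<length u} (succ_in {..<length u}) ((!) u)"
proof -
  obtain m where m: "length u = Suc m" using assms by (cases u) auto
  have "accepts (class_aut W (last_states W (ends 1 6))) u \<longleftrightarrow>
    (\<exists>\<rho>. \<rho> 0 = 0 \<and> (\<forall>i<length u. \<rho> (Suc i) = Suc (u ! i) \<and>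
      (\<rho> i \<le> Suc W \<and> u ! i \<le> W \<and> reads (starts 3 5) (links 1 3 5 6) (\<rho> i) (u ! i))) \<and>
      \<rho> (length u) \<in> last_states W (ends 1 6))"
    unfolding accepts_def class_aut_def by simp (meson)
  also have "\<dots> \<longleftrightarrow> (\<forall>i<length u. run ((!) u) i \<le> Suc W \<and> u ! i \<le> W \<and>
      reads (starts 3 5) (links 1 3 5 6) (run ((!) u) i) (u ! i)) \<and>
      run ((!) u) (length u) \<in> last_states W (ends 1 6)"
    by (rule ex_run_finite)
  also have "\<dots> \<longleftrightarrow> (\<forall>i<length u. u ! i \<le> W) \<and>
     class_tied {..<length u} (succ_in {..<length u}) ((!) u)"
  proof -
    have "(\<forall>i\<in>{..<length u}. Suc i \<notin> {..<length u} \<longrightarrow> ends 1 6 (u ! i)) \<longleftrightarrow> ends 1 6 (u ! m)"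
      unfolding m by (auto simp: less_Suc_eq)
    moreover have "(\<forall>i<length u. u ! i \<le> W) \<Longrightarrow>
        run ((!) u) (length u) \<in> last_states W (ends 1 6) \<longleftrightarrow> ends 1 6 (u ! m)"
      unfolding m by (auto simp: last_states_def)
    ultimately show ?thesis
      using run_le[of "length u" "(!) u" W] by (subst tied_succ_in) auto
  qed
  finally show ?thesis .
qed

text \<open>Every index of \<open>UNIV\<close> has a successor, so the end test is vacuous, and
  every run is accepting.\<close>

lemma buchi_accepts_class_aut:
  "buchi_accepts (class_aut W {..Suc W}) f \<longleftrightarrow> (\<forall>i. f i \<le> W) \<and> class_tied UNIV (succ_in UNIV) f"
proof -
  have "buchi_accepts (class_aut W {..Suc W}) f \<longleftrightarrow>
    (\<exists>\<rho>. \<rho> 0 = 0 \<and> (\<forall>i. \<rho> (Suc i) = Suc (f i) \<and>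
      (\<rho> i \<le> Suc W \<and> f i \<le> W \<and> reads (starts 3 5) (links 1 3 5 6) (\<rho> i) (f i))) \<and>
      (\<exists>\<^sub>\<infinity>i. \<rho> i \<le> Suc W))"
    unfolding buchi_accepts_def class_aut_def by simp (meson)
  also have "\<dots> \<longleftrightarrow> (\<forall>i. run f i \<le> Suc W \<and> f i \<le> W \<and>
      reads (starts 3 5) (links 1 3 5 6) (run f i) (f i)) \<and> (\<exists>\<^sub>\<infinity>i. run f i \<le> Suc W)"
    by (rule ex_run_infinite)
  also have "\<dots> \<longleftrightarrow> (\<forall>i. f i \<le> W) \<and> class_tied UNIV (succ_in UNIV) f"
  proof -
    have "run f i \<le> Suc W" if "\<forall>i. f i \<le> W" for i
      using that by (cases i) auto
    then show ?thesis by (subst tied_succ_in) auto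
  qed
  finally show ?thesis .
qed

lemma transduces_base_aut:
  assumes "u \<noteq> []"
  shows "transduces (base_aut c n W) u v \<longleftrightarrow> length v = length u \<and> item n 0 \<in> set_decode (v ! 0) \<and>
    (\<forall>i<length u. v ! i \<le> W \<and> local_ok (c (letter (Fin u) i)) (of_bool (P_at (Fin u) i))
      (of_bool (S_at (Fin u) i)) (v ! i)) \<and>
    global_tied {..<length u} (succ_in {..<length u}) ((!) v)"
proof (cases "length v = length u")
  case True
  let ?I = "\<lambda>b. starts 2 3 b \<and> item n 0 \<in> set_decode b"
  define L where "L i = local_ok (c (letter (Fin u) i)) (of_bool (P_at (Fin u) i)) (of_bool (S_at (Fin u) i)) (v ! i)" for i
  obtain m where m: "length u = Suc m" using assms by (cases u) auto
  have "transduces (base_aut c n W) u v \<longleftrightarrow>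
    (\<exists>\<rho>. \<rho> 0 = 0 \<and> (\<forall>i<length u. \<rho> (Suc i) = Suc (v ! i) \<and>
      (\<rho> i \<le> Suc W \<and> v ! i \<le> W \<and> L i \<and> reads ?I (links 0 2 3 4) (\<rho> i) (v ! i))) \<and>
      \<rho> (length u) \<in> last_states W (ends 0 4))"
    unfolding transduces_def base_aut_def using True by (simp add: marked_letter_def L_def conj_ac)
  also have "\<dots> \<longleftrightarrow> (\<forall>i<length u. run ((!) v) i \<le> Suc W \<and> v ! i \<le> W \<and> L i \<and>
      reads ?I (links 0 2 3 4) (run ((!) v) i) (v ! i)) \<and>
      run ((!) v) (length u) \<in> last_states W (ends 0 4)"
    by (rule ex_run_finite)
  also have "\<dots> \<longleftrightarrow> (\<forall>i<length u. v ! i \<le> W \<and> L i) \<and>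
     tied ?I (links 0 2 3 4) (ends 0 4) {..<length u} (succ_in {..<length u}) ((!) v)"
  proof -
    have "(\<forall>i\<in>{..<length u}. Suc i \<notin> {..<length u} \<longrightarrow> ends 0 4 (v ! i)) \<longleftrightarrow> ends 0 4 (v ! m)"
      unfolding m by (auto simp: less_Suc_eq)
    moreover have "(\<forall>i<length u. v ! i \<le> W) \<Longrightarrow>
        run ((!) v) (length u) \<in> last_states W (ends 0 4) \<longleftrightarrow> ends 0 4 (v ! m)"
      unfolding m by (auto simp: last_states_def)
    ultimately show ?thesis
      using run_le[of "length u" "(!) v" W] by (subst tied_succ_in) auto
  qed
  also have "tied ?I (links 0 2 3 4) (ends 0 4) {..<length u} (succ_in {..<length u}) ((!) v) \<longleftrightarrow>
     global_tied {..<length u} (succ_in {..<length u}) ((!) v) \<and> item n 0 \<in> set_decode (v ! 0)"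
    using assms by (subst tied_initial) auto
  finally show ?thesis using True unfolding L_def by blast
qed (simp add: transduces_def)

lemma not_transduces_Nil: "\<not> transduces (base_aut c n W) [] v"
  by (auto simp: transduces_def base_aut_def last_states_def)

lemma omega_transduces_base_aut:
  "omega_transduces (base_aut c n W) f g \<longleftrightarrow> item n 0 \<in> set_decode (g 0) \<and>
    (\<forall>i. g i \<le> W \<and> local_ok (c (letter (Inf f) i)) (of_bool (P_at (Inf f) i))
      (of_bool (S_at (Inf f) i)) (g i)) \<and>
    global_tied UNIV (succ_in UNIV) g"
proof -
  let ?I = "\<lambda>b. starts 2 3 b \<and> item n 0 \<in> set_decode b"
  define L where "L i = local_ok (c (letter (Inf f) i)) (of_bool (P_at (Inf f) i)) (of_bool (S_at (Inf f) i)) (g i)" for i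
  have "omega_transduces (base_aut c n W) f g \<longleftrightarrow>
    (\<exists>\<rho>. \<rho> 0 = 0 \<and> (\<forall>i. \<rho> (Suc i) = Suc (g i) \<and>
      (\<rho> i \<le> Suc W \<and> g i \<le> W \<and> L i \<and> reads ?I (links 0 2 3 4) (\<rho> i) (g i))) \<and>
      (\<exists>\<^sub>\<infinity>i. \<rho> i \<le> Suc W))"
    unfolding omega_transduces_def base_aut_def by (simp add: marked_letter_def L_def conj_ac)
  also have "\<dots> \<longleftrightarrow> (\<forall>i. run g i \<le> Suc W \<and> g i \<le> W \<and> L i \<and>
      reads ?I (links 0 2 3 4) (run g i) (g i)) \<and> (\<exists>\<^sub>\<infinity>i. run g i \<le> Suc W)"
    by (rule ex_run_infinite)
  also have "\<dots> \<longleftrightarrow> (\<forall>i. g i \<le> W \<and> L i) \<and>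
     tied ?I (links 0 2 3 4) (ends 0 4) UNIV (succ_in UNIV) g"
  proof -
    have "run g i \<le> Suc W" if "\<forall>i. g i \<le> W" for i
      using that by (cases i) auto
    then show ?thesis by (subst tied_succ_in) auto
  qed
  also have "tied ?I (links 0 2 3 4) (ends 0 4) UNIV (succ_in UNIV) g \<longleftrightarrow>
     global_tied UNIV (succ_in UNIV) g \<and> item n 0 \<in> set_decode (g 0)"
    by (subst tied_initial) auto
  finally show ?thesis unfolding L_def by blast
qed

section \<open>Transfer between a class of positions and the word read along it\<close>

lemma tied_image:
  assumes "inj_on e D" "\<And>i j. R i j \<Longrightarrow> i \<in> D \<and> j \<in> D"
    "\<And>i j. R' i j \<longleftrightarrow> (\<exists>k l. i = e k \<and> j = e l \<and> R k l)"
  shows "tied I J Z D R (\<lambda>k. lab (e k)) \<longleftrightarrow> tied I J Z (e ` D) R' lab"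
proof -
  have R': "R' (e k) j \<longleftrightarrow> (\<exists>l. j = e l \<and> R k l)" "R' j (e k) \<longleftrightarrow> (\<exists>l. j = e l \<and> R l k)"
    if "k \<in> D" for k j
    using that assms(2) inj_onD[OF assms(1)] unfolding assms(3) by metis+
  have "(\<exists>j. R' j (e k)) \<longleftrightarrow> (\<exists>j. R j k)" "(\<exists>j. R' (e k) j) \<longleftrightarrow> (\<exists>j. R k j)" if "k \<in> D" for k
    unfolding R'[OF that] by blast+
  then have "(\<forall>i\<in>e ` D. (\<nexists>j. R' j i) \<longrightarrow> I (lab i)) \<longleftrightarrow> (\<forall>k\<in>D. (\<nexists>j. R j k) \<longrightarrow> I (lab (e k)))"
    "(\<forall>i\<in>e ` D. (\<nexists>j. R' i j) \<longrightarrow> Z (lab i)) \<longleftrightarrow> (\<forall>k\<in>D. (\<nexists>j. R k j) \<longrightarrow> Z (lab (e k)))"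
    by (simp_all del: not_ex cong: ball_cong)
  moreover have "(\<forall>i j. R' i j \<longrightarrow> J (lab i) (lab j)) \<longleftrightarrow> (\<forall>k l. R k l \<longrightarrow> J (lab (e k)) (lab (e l)))"
    unfolding assms(3) by blast
  ultimately show ?thesis
    unfolding tied_def by (simp only:)
qed

text \<open>An increasing enumeration of a class by an initial segment leaves no gaps, so
  consecutive indices are exactly class successors.\<close>

lemma class_succ_enum:
  assumes "K \<in> classes w" "e ` D = K" "strict_mono_on D e" "\<And>i j. j \<in> D \<Longrightarrow> i \<le> j \<Longrightarrow> i \<in> D"
  shows "i \<in> K \<and> class_succ w i j \<longleftrightarrow> (\<exists>k l. i = e k \<and> j = e l \<and> succ_in D k l)"
proof -
  obtain d where K: "K = {i \<in> positions w. datum w i = d}"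
    using assms(1) unfolding classes_def by blast
  have cs: "i \<in> K \<and> class_succ w i j \<longleftrightarrow> i \<in> K \<and> j \<in> K \<and> i < j \<and> (\<forall>k\<in>K. \<not> (i < k \<and> k < j))"
    using positions_downward[of j w] unfolding class_succ_def K by fastforce
  have less: "e k < e l \<longleftrightarrow> k < l" if "k \<in> D" "l \<in> D" for k l
    using that assms(3) by (simp add: strict_mono_on_less)
  show ?thesis
  proof
    assume "i \<in> K \<and> class_succ w i j"
    then have "i \<in> e ` D \<and> j \<in> e ` D \<and> i < j \<and> (\<forall>k\<in>e ` D. \<not> (i < k \<and> k < j))"
      unfolding cs assms(2) .
    then obtain k l where kl: "k \<in> D" "l \<in> D" "i = e k" "j = e l" "e k < e l"
        "\<forall>m\<in>D. \<not> (e k < e m \<and> e m < e l)"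
      by blast
    then have "k < l" using less by blast
    moreover from this have "Suc k \<in> D" using assms(4) kl(2) by simp
    then have "\<not> Suc k < l" using kl less by blast
    ultimately have "l = Suc k" by simp
    with kl show "\<exists>k l. i = e k \<and> j = e l \<and> succ_in D k l" unfolding succ_in_def by blast
  next
    assume "\<exists>k l. i = e k \<and> j = e l \<and> succ_in D k l"
    then obtain k where k: "i = e k" "j = e (Suc k)" "k \<in> D" "Suc k \<in> D"
      unfolding succ_in_def by blast
    then have "\<forall>m\<in>D. \<not> (e k < e m \<and> e m < e (Suc k))" using less by fastforce
    with k have "i \<in> e ` D \<and> j \<in> e ` D \<and> i < j \<and> (\<forall>k\<in>e ` D. \<not> (i < k \<and> k < j))"
      using less by simp
    then show "i \<in> K \<and> class_succ w i j"
      unfolding cs assms(2) .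
  qed
qed

lemma tied_class_enum:
  assumes "K \<in> classes w" "e ` D = K" "strict_mono_on D e" "\<And>i j. j \<in> D \<Longrightarrow> i \<le> j \<Longrightarrow> i \<in> D"
  shows "tied I J Z D (succ_in D) (\<lambda>k. lab (e k)) \<longleftrightarrow>
    tied I J Z K (\<lambda>i j. i \<in> K \<and> class_succ w i j) lab"
  unfolding assms(2)[symmetric]
  using class_succ_enum[OF assms] assms(2) strict_mono_on_imp_inj_on[OF assms(3)]
  by (intro tied_image) (auto simp: succ_in_def)

text \<open>Class successor edges never leave a class and the classes cover all positions. All three
  tests can thus be attached to single positions, as the predicate \<open>B\<close> does, and
  regrouped by classes.\<close>

lemma tied_classes:
  "tied I J Z (positions w) (class_succ w) lab \<longleftrightarrow>
    (\<forall>K\<in>classes w. tied I J Z K (\<lambda>i j. i \<in> K \<and> class_succ w i j) lab)"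
proof -
  define B where "B i \<longleftrightarrow> ((\<nexists>j. class_succ w j i) \<longrightarrow> I (lab i)) \<and>
    (\<forall>j. class_succ w i j \<longrightarrow> J (lab i) (lab j)) \<and> ((\<nexists>j. class_succ w i j) \<longrightarrow> Z (lab i))" for i
  have same: "i \<in> K \<longleftrightarrow> j \<in> K" if "class_succ w i j" "K \<in> classes w" for i j K
    using that unfolding class_succ_def classes_def by auto
  have "tied I J Z K (\<lambda>i j. i \<in> K \<and> class_succ w i j) lab \<longleftrightarrow> (\<forall>i\<in>K. B i)"
    if "K \<in> classes w" for K
  proof -
    have "(\<exists>j. j \<in> K \<and> class_succ w j i) \<longleftrightarrow> (\<exists>j. class_succ w j i)" if "i \<in> K" for i
      using that same \<open>K \<in> classes w\<close> by blast
    then show ?thesis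
      by (auto simp: tied_def B_def simp del: not_ex cong: ball_cong)
  qed
  moreover have "tied I J Z (positions w) (class_succ w) lab \<longleftrightarrow> (\<forall>i\<in>positions w. B i)"
    using class_succ_positions by (fastforce simp: tied_def B_def simp del: not_ex)
  moreover have "positions w = \<Union>(classes w)"
    unfolding classes_def by blast
  ultimately show ?thesis by simp
qed

lemma tied_cong:
  assumes "\<And>i j. R i j \<Longrightarrow> i \<in> K \<and> j \<in> K" "\<And>i. i \<in> K \<Longrightarrow> lab i = lab' i"
  shows "tied I J Z K R lab \<longleftrightarrow> tied I J Z K R lab'"
proof -
  have "(\<forall>i j. R i j \<longrightarrow> J (lab i) (lab j)) \<longleftrightarrow> (\<forall>i j. R i j \<longrightarrow> J (lab' i) (lab' j))"
    using assms by (metis (no_types))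
  then show ?thesis using assms(2) by (simp add: tied_def)
qed

lemma consistent_cong:
  assumes "\<And>i. i \<in> positions w \<Longrightarrow> lab i = lab' i"
  shows "consistent c n w lab \<longleftrightarrow> consistent c n w lab'"
proof -
  have "global_tied (positions w) (global_succ w) lab \<longleftrightarrow> global_tied (positions w) (global_succ w) lab'"
    using assms global_succ_positions by (intro tied_cong)
  moreover have "class_tied (positions w) (class_succ w) lab \<longleftrightarrow> class_tied (positions w) (class_succ w) lab'"
    using assms class_succ_positions by (intro tied_cong)
  ultimately show ?thesis using assms unfolding consistent_def by (simp cong: conj_cong)
qed

lemma accepts_finite_class_word:
  assumes "K \<in> classes w" "finite K" "\<forall>i\<in>K. letter w i \<le> W"
  shows "accepts (class_aut W (last_states W (ends 1 6))) (finite_class_word w K) \<longleftrightarrow>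
    class_tied K (\<lambda>i j. i \<in> K \<and> class_succ w i j) (letter w)"
proof -
  define s where "s = sorted_list_of_set K"
  have s: "set s = K" "sorted_wrt (<) s" using assms(2) by (simp_all add: s_def)
  have word: "finite_class_word w K = map (letter w) s" by (simp add: finite_class_word_def s_def)
  have "s \<noteq> []" using s assms(1) unfolding classes_def by auto
  have "class_tied {..<length s} (succ_in {..<length s}) (\<lambda>k. letter w (s ! k)) \<longleftrightarrow>
    class_tied K (\<lambda>i j. i \<in> K \<and> class_succ w i j) (letter w)"
  proof (rule tied_class_enum[OF assms(1)])
    show "(!) s ` {..<length s} = K" using s(1) by (auto simp: set_conv_nth)
    show "strict_mono_on {..<length s} ((!) s)"
      using s(2) by (auto simp: strict_mono_on_def sorted_wrt_nth_less)
  qed auto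
  moreover have "class_tied {..<length s} (succ_in {..<length s}) ((!) (map (letter w) s)) \<longleftrightarrow>
    class_tied {..<length s} (succ_in {..<length s}) (\<lambda>k. letter w (s ! k))"
    by (intro tied_cong) (auto simp: succ_in_def)
  moreover have "\<forall>i<length s. letter w (s ! i) \<le> W"
    using assms(3) s(1) nth_mem by blast
  ultimately show ?thesis
    unfolding word using accepts_class_aut[of "map (letter w) s" W] \<open>s \<noteq> []\<close> by simp
qed

lemma buchi_accepts_infinite_class_word:
  assumes "K \<in> classes w" "infinite K" "\<forall>i\<in>K. letter w i \<le> W"
  shows "buchi_accepts (class_aut W {..Suc W}) (infinite_class_word w K) \<longleftrightarrow>
    class_tied K (\<lambda>i j. i \<in> K \<and> class_succ w i j) (letter w)"
proof -
  have "infinite_class_word w K = (\<lambda>k. letter w (enumerate K k))"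
    by (rule ext) (simp add: infinite_class_word_def)
  moreover have "class_tied UNIV (succ_in UNIV) (\<lambda>k. letter w (enumerate K k)) \<longleftrightarrow>
    class_tied K (\<lambda>i j. i \<in> K \<and> class_succ w i j) (letter w)"
    using assms(1,2) range_enumerate[of K]
    by (intro tied_class_enum) (auto simp: strict_mono_on_def enumerate_mono)
  moreover have "\<forall>k. letter w (enumerate K k) \<le> W"
    using assms(2,3) enumerate_in_set by blast
  ultimately show ?thesis unfolding buchi_accepts_class_aut by simp
qed

text \<open>Needed because the class automata read the output word, which has other letters but the
  data values of the input.\<close>

lemma class_structure_cong:
  assumes "positions w = positions w'" "\<And>i. i \<in> positions w \<Longrightarrow> datum w i = datum w' i"
  shows "class_succ w = class_succ w'" "classes w = classes w'"
proof -
  have "class_succ w i j \<longleftrightarrow> class_succ w' i j" for i j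
  proof (cases "i \<in> positions w \<and> j \<in> positions w")
    case True
    \<comment> \<open>Class successors also inspect the values strictly between \<open>i\<close> and
      \<open>j\<close>. These indices lie in the word by downward closure, which matters since
      \<open>datum\<close> is arbitrary outside of it.\<close>
    then have "datum w' k = datum w k" if "k \<le> i \<or> k \<le> j" for k
      using that assms(2) positions_downward by metis
    then show ?thesis
      using assms(1) unfolding class_succ_def by (simp add: less_imp_le cong: conj_cong imp_cong)
  qed (use assms(1) in \<open>auto simp: class_succ_def\<close>)
  then show "class_succ w = class_succ w'" by blast
  have "{i \<in> positions w. datum w i = d} = {i \<in> positions w'. datum w' i = d}" for d
    using assms by auto
  then show "classes w = classes w'"
    unfolding classes_def by simp
qed

text \<open>An automaton restricts the labels of positions only; soundness, which asks for no bound,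
  covers labellings that are large elsewhere.\<close>

lemma satisfies_iff_bounded_consistent:
  assumes "inj c" "nu_fragment \<phi>" "n = formula_code c \<phi>"
  shows "satisfies w \<phi> \<longleftrightarrow>
    (\<exists>lab. consistent c n w lab \<and> (\<forall>i\<in>positions w. lab i \<le> label_bound n))"
  using satisfies_iff_consistent[OF assms(1,2)] consistent_imp_satisfies[OF _ assms(1,2)] assms(3)
  by blast

lemma automaton_language_formula_aut:
  fixes c :: "'a \<Rightarrow> nat"
  assumes "inj c" "nu_fragment \<phi>" "n = formula_code c \<phi>"
  shows "automaton_language (data_automaton.truncate (formula_aut c n)) = data_language \<phi>"
proof (rule set_eqI)
  fix u :: "('a \<times> 'd) list"
  define W where "W = label_bound n"
  let ?A = "data_automaton.truncate (formula_aut c n)" and ?w = "\<lambda>v. Fin (zip v (map snd u))"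
  have iff: "transduces (base ?A) u v \<and>
      (\<forall>K\<in>classes (?w v). accepts (class_automaton ?A) (finite_class_word (?w v) K)) \<longleftrightarrow>
    length v = length u \<and> consistent c n (Fin u) ((!) v) \<and> (\<forall>i<length u. v ! i \<le> W)" for v
  \<comment> \<open>In the other case both sides fail: the transducer enforces the length and the
    bound on labels, and the empty word has neither an accepting run nor a position 0.\<close>
  proof (cases "u \<noteq> [] \<and> length v = length u \<and> (\<forall>i<length u. v ! i \<le> W)")
    case True
    have pos: "positions (?w v) = positions (Fin u)" using True by simp
    have datum: "datum (?w v) i = datum (Fin u) i" if "i \<in> positions (?w v)" for i
      using that True by (simp add: datum_def)
    have lett: "letter (?w v) i = v ! i" if "i \<in> positions (Fin u)" for i
      using that True by (simp add: letter_def)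
    have cs: "class_succ (?w v) = class_succ (Fin u)"
      by (rule class_structure_cong(1)[OF pos datum])
    have "(\<forall>K\<in>classes (?w v). accepts (class_automaton ?A) (finite_class_word (?w v) K)) \<longleftrightarrow>
      (\<forall>K\<in>classes (?w v). class_tied K (\<lambda>i j. i \<in> K \<and> class_succ (?w v) i j) (letter (?w v)))"
    proof (intro ball_cong refl)
      fix K assume K: "K \<in> classes (?w v)"
      then have sub: "K \<subseteq> positions (?w v)" unfolding classes_def by blast
      then have "finite K" unfolding pos by (simp add: finite_subset)
      moreover have "\<forall>i\<in>K. letter (?w v) i \<le> W" using sub lett True by auto
      ultimately show "accepts (class_automaton ?A) (finite_class_word (?w v) K) \<longleftrightarrow>
        class_tied K (\<lambda>i j. i \<in> K \<and> class_succ (?w v) i j) (letter (?w v))"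
        using accepts_finite_class_word[OF K]
        by (simp add: formula_aut_def data_automaton.defs W_def)
    qed
    \<comment> \<open>The per-class conditions are joined over the output word first; then its
      positions and class successors are replaced by those of the input.\<close>
    also have "\<dots> \<longleftrightarrow> class_tied (positions (Fin u)) (class_succ (Fin u)) (letter (?w v))"
      unfolding tied_classes[symmetric] unfolding pos cs ..
    also have "\<dots> \<longleftrightarrow> class_tied (positions (Fin u)) (class_succ (Fin u)) ((!) v)"
      using class_succ_positions lett by (intro tied_cong)
    finally show ?thesis
      using True transduces_base_aut[of u c n W v]
      by (auto simp: consistent_def global_succ_eq formula_aut_def data_automaton.defs W_def)
  next
    case False
    then have "\<not> transduces (base ?A) u v"
      using transduces_base_aut[of u c n W v] not_transduces_Nil[of c n W v]
      by (auto simp: formula_aut_def data_automaton.defs W_def)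
    moreover have "\<not> (length v = length u \<and> consistent c n (Fin u) ((!) v) \<and> (\<forall>i<length u. v ! i \<le> W))"
      using False by (auto simp: consistent_def)
    ultimately show ?thesis by blast
  qed
  have "u \<in> automaton_language ?A \<longleftrightarrow>
      (\<exists>v. length v = length u \<and> consistent c n (Fin u) ((!) v) \<and> (\<forall>i<length u. v ! i \<le> W))"
    unfolding automaton_language_def Let_def iff[symmetric] by simp
  also have "\<dots> \<longleftrightarrow> (\<exists>lab. consistent c n (Fin u) lab \<and> (\<forall>i\<in>positions (Fin u). lab i \<le> W))"
  proof
    assume "\<exists>lab. consistent c n (Fin u) lab \<and> (\<forall>i\<in>positions (Fin u). lab i \<le> W)"
    then obtain lab where "consistent c n (Fin u) lab" "\<forall>i\<in>positions (Fin u). lab i \<le> W" by blast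
    then show "\<exists>v. length v = length u \<and> consistent c n (Fin u) ((!) v) \<and> (\<forall>i<length u. v ! i \<le> W)"
      using consistent_cong[of "Fin u" "(!) (map lab [0..<length u])" lab]
      by (intro exI[of _ "map lab [0..<length u]"]) simp
  qed auto
  finally show "u \<in> automaton_language ?A \<longleftrightarrow> u \<in> data_language \<phi>"
    using satisfies_iff_bounded_consistent[OF assms, of "Fin u"] by (simp add: data_language_def W_def)
qed

lemma automaton_omega_language_formula_aut:
  fixes c :: "'a \<Rightarrow> nat"
  assumes "inj c" "nu_fragment \<phi>" "n = formula_code c \<phi>"
  shows "automaton_omega_language (formula_aut c n) = data_omega_language \<phi>"
proof (rule set_eqI)
  fix f :: "nat \<Rightarrow> 'a \<times> 'd"
  define W where "W = label_bound n"
  let ?A = "formula_aut c n" and ?w = "\<lambda>g. Inf (\<lambda>i. (g i, snd (f i)))"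
  have iff: "omega_transduces (base ?A) f g \<and>
      (\<forall>K\<in>classes (?w g). if finite K then accepts (class_automaton ?A) (finite_class_word (?w g) K)
         else buchi_accepts (class_buchi ?A) (infinite_class_word (?w g) K)) \<longleftrightarrow>
    consistent c n (Inf f) g \<and> (\<forall>i. g i \<le> W)" for g
  proof (cases "\<forall>i. g i \<le> W")
    case True
    have pos: "positions (?w g) = positions (Inf f)" by simp
    have datum: "datum (?w g) i = datum (Inf f) i" for i
      by (simp add: datum_def)
    have lett: "letter (?w g) = g"
      by (rule ext) (simp add: letter_def)
    have cs: "class_succ (?w g) = class_succ (Inf f)"
      by (rule class_structure_cong(1)[OF pos datum])
    have "(\<forall>K\<in>classes (?w g). if finite K then accepts (class_automaton ?A) (finite_class_word (?w g) K)
         else buchi_accepts (class_buchi ?A) (infinite_class_word (?w g) K)) \<longleftrightarrow>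
      (\<forall>K\<in>classes (?w g). class_tied K (\<lambda>i j. i \<in> K \<and> class_succ (?w g) i j) g)"
    proof (intro ball_cong refl)
      fix K assume K: "K \<in> classes (?w g)"
      have "\<forall>i\<in>K. letter (?w g) i \<le> W" using lett True by simp
      with accepts_finite_class_word[OF K _ this] buchi_accepts_infinite_class_word[OF K _ this]
      show "(if finite K then accepts (class_automaton ?A) (finite_class_word (?w g) K)
         else buchi_accepts (class_buchi ?A) (infinite_class_word (?w g) K)) \<longleftrightarrow>
        class_tied K (\<lambda>i j. i \<in> K \<and> class_succ (?w g) i j) g"
        by (simp add: formula_aut_def W_def lett)
    qed
    also have "\<dots> \<longleftrightarrow> class_tied (positions (Inf f)) (class_succ (Inf f)) g"
      unfolding tied_classes[symmetric] unfolding pos cs ..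
    finally show ?thesis
      using True omega_transduces_base_aut[of c n W f g]
      by (auto simp: consistent_def global_succ_eq formula_aut_def W_def)
  next
    case False
    then show ?thesis
      using omega_transduces_base_aut[of c n W f g] by (auto simp: formula_aut_def W_def)
  qed
  show "f \<in> automaton_omega_language ?A \<longleftrightarrow> f \<in> data_omega_language \<phi>"
    unfolding automaton_omega_language_def Let_def mem_Collect_eq iff
    using satisfies_iff_bounded_consistent[OF assms, of "Inf f"] by (simp add: data_omega_language_def W_def)
qed

section \<open>Computing the automata\<close>

lemma decidable_lift1:
  "decidable (\<lambda>e. h (e 0)) \<Longrightarrow> computable F \<Longrightarrow> decidable (\<lambda>e. h (F e))"
  unfolding decidable_def by (rule computable_lift1[where h = "\<lambda>x. of_bool (h x)"])

lemma decidable_lift2: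
  "decidable (\<lambda>e. h (e 0) (e 1)) \<Longrightarrow> computable F \<Longrightarrow> computable G \<Longrightarrow> decidable (\<lambda>e. h (F e) (G e))"
  unfolding decidable_def by (rule computable_lift2[where h = "\<lambda>x y. of_bool (h x y)"])

lemma decidable_lift4:
  "decidable (\<lambda>e. h (e 0) (e 1) (e 2) (e 3)) \<Longrightarrow> computable F \<Longrightarrow> computable G \<Longrightarrow> computable H \<Longrightarrow>
    computable I \<Longrightarrow> decidable (\<lambda>e. h (F e) (G e) (H e) (I e))"
  unfolding decidable_def by (rule computable_lift4[where h = "\<lambda>x y z u. of_bool (h x y z u)"])

lemma decidable_const [computable_intros]: "decidable (\<lambda>e. P)"
  unfolding decidable_def by (rule computable_const)

text \<open>From \<open>t < 2 ^ t\<close> and \<open>2 ^ t \<le> b\<close>. Components of an item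
  are smaller than the item, so a label bounds all quantifiers over the items it contains.\<close>

lemma mem_set_decode_less:
  assumes "t \<in> set_decode b"
  shows "t < b"
proof -
  have "set_encode {t} \<le> b"
    using assms set_encode_inverse[of "{t}"] by (intro subset_decode_imp_le) simp
  then have "2 ^ t \<le> b" by (simp add: set_encode_def)
  with less_exp show ?thesis by (rule less_le_trans)
qed

lemma mem_item_le:
  assumes "item (list_encode xs) E \<in> set_decode b"
  shows "E \<le> b \<and> (\<forall>x\<in>set xs. x \<le> b)"
  using mem_set_decode_less[OF assms] le_prod_encode_1[of "list_encode xs" E]
    le_prod_encode_2[of E "list_encode xs"] less_list_encode[of _ xs]
  by force

lemma bounded_items:
  "(\<forall>E. item (list_encode xs) E \<in> set_decode b \<longrightarrow> Q E) \<longleftrightarrow>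
    (\<forall>E\<le>b. item (list_encode xs) E \<in> set_decode b \<longrightarrow> Q E)"
  "(\<forall>x E. item (list_encode [k, x]) E \<in> set_decode b \<longrightarrow> R x E) \<longleftrightarrow>
    (\<forall>x\<le>b. \<forall>E\<le>b. item (list_encode [k, x]) E \<in> set_decode b \<longrightarrow> R x E)"
  "(\<forall>x y E. item (list_encode [k, x, y]) E \<in> set_decode b \<longrightarrow> S x y E) \<longleftrightarrow>
    (\<forall>x\<le>b. \<forall>y\<le>b. \<forall>E\<le>b. item (list_encode [k, x, y]) E \<in> set_decode b \<longrightarrow> S x y E)"
  "(\<forall>y E. item (list_encode [k, m, y]) E \<in> set_decode b \<longrightarrow> R y E) \<longleftrightarrow>
    (\<forall>y\<le>b. \<forall>E\<le>b. item (list_encode [k, m, y]) E \<in> set_decode b \<longrightarrow> R y E)"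
proof -
  have "E \<le> b" if "item (list_encode xs) E \<in> set_decode b" for E
    using mem_item_le[OF that] by simp
  then show "(\<forall>E. item (list_encode xs) E \<in> set_decode b \<longrightarrow> Q E) \<longleftrightarrow>
    (\<forall>E\<le>b. item (list_encode xs) E \<in> set_decode b \<longrightarrow> Q E)" by blast
  have "x \<le> b \<and> E \<le> b" if "item (list_encode [k, x]) E \<in> set_decode b" for x E
    using mem_item_le[OF that] by simp
  then show "(\<forall>x E. item (list_encode [k, x]) E \<in> set_decode b \<longrightarrow> R x E) \<longleftrightarrow>
    (\<forall>x\<le>b. \<forall>E\<le>b. item (list_encode [k, x]) E \<in> set_decode b \<longrightarrow> R x E)" by blast
  have *: "x \<le> b \<and> y \<le> b \<and> E \<le> b" if "item (list_encode [k, x, y]) E \<in> set_decode b" for x y E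
    using mem_item_le[OF that] by simp
  then show "(\<forall>x y E. item (list_encode [k, x, y]) E \<in> set_decode b \<longrightarrow> S x y E) \<longleftrightarrow>
    (\<forall>x\<le>b. \<forall>y\<le>b. \<forall>E\<le>b. item (list_encode [k, x, y]) E \<in> set_decode b \<longrightarrow> S x y E)" by blast
  show "(\<forall>y E. item (list_encode [k, m, y]) E \<in> set_decode b \<longrightarrow> R y E) \<longleftrightarrow>
    (\<forall>y\<le>b. \<forall>E\<le>b. item (list_encode [k, m, y]) E \<in> set_decode b \<longrightarrow> R y E)"
    using * by blast
qed

lemma bounded_letters:
  "(\<forall>l E. item (list_encode [k, list_encode [0, l]]) E \<in> set_decode b \<longrightarrow> R l E) \<longleftrightarrow>
    (\<forall>l\<le>b. \<forall>E\<le>b. item (list_encode [k, list_encode [0, l]]) E \<in> set_decode b \<longrightarrow> R l E)"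
proof -
  have "l \<le> b \<and> E \<le> b" if "item (list_encode [k, list_encode [0, l]]) E \<in> set_decode b" for l E
    using mem_item_le[OF that] less_list_encode[of l "[0, l]"] by simp
  then show ?thesis by blast
qed

lemma bounded_ex_item:
  "(\<exists>y f D. E = item (list_encode [k, y, f]) D \<and> R y f D) \<longleftrightarrow>
    (\<exists>y\<le>E. \<exists>f\<le>E. \<exists>D\<le>E. E = item (list_encode [k, y, f]) D \<and> R y f D)"
proof -
  have "y \<le> item (list_encode [k, y, f]) D \<and> f \<le> item (list_encode [k, y, f]) D \<and>
    D \<le> item (list_encode [k, y, f]) D" for y f D
    using le_prod_encode_1[of "list_encode [k, y, f]" D] le_prod_encode_2[of D "list_encode [k, y, f]"]
      less_list_encode[of y "[k, y, f]"] less_list_encode[of f "[k, y, f]"]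
    by simp
  then show ?thesis by blast
qed

lemma decidable_has_atom [computable_intros]:
  assumes "computable F"
  shows "decidable (\<lambda>e. has_atom k A (F e))"
proof (rule decidable_lift1[OF _ assms])
  have *: "has_atom k A b \<longleftrightarrow> \<not> (\<forall>E. item (list_encode [k, list_encode [A]]) E \<in> set_decode b \<longrightarrow> False)"
    for b by (simp add: has_atom_def)
  show "decidable (\<lambda>e. has_atom k A (e 0))"
    unfolding * bounded_items(1) by (intro computable_intros)
qed

lemma decidable_no_mod [computable_intros]:
  assumes "computable F"
  shows "decidable (\<lambda>e. no_mod m (F e))"
proof (rule decidable_lift1[OF _ assms])
  have *: "no_mod m b \<longleftrightarrow> (\<forall>f E. item (list_encode [3, m, f]) E \<in> set_decode b \<longrightarrow> False)"
    for b by (simp add: no_mod_def)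
  show "decidable (\<lambda>e. no_mod m (e 0))"
    unfolding * bounded_items(4) by (intro computable_intros)
qed

lemma decidable_mod_step [computable_intros]:
  assumes "computable F" "computable G"
  shows "decidable (\<lambda>e. mod_step m (F e) (G e))"
proof (rule decidable_lift2[OF _ assms])
  show "decidable (\<lambda>e. mod_step m (e 0) (e 1))"
    unfolding mod_step_def bounded_items(4) by (intro computable_intros)
qed

lemma decidable_starts [computable_intros]: "computable F \<Longrightarrow> decidable (\<lambda>e. starts Y A (F e))"
  unfolding starts_def by (intro computable_intros)

lemma decidable_links [computable_intros]:
  "computable F \<Longrightarrow> computable G \<Longrightarrow> decidable (\<lambda>e. links X Y A L (F e) (G e))"
  unfolding links_def by (intro computable_intros)

lemma decidable_ends [computable_intros]: "computable F \<Longrightarrow> decidable (\<lambda>e. ends X L (F e))"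
  unfolding ends_def by (intro computable_intros)

lemma decidable_local_ok [computable_intros]:
  assumes "computable F" "computable G" "computable H" "computable I"
  shows "decidable (\<lambda>e. local_ok (F e) (G e) (H e) (I e))"
proof (rule decidable_lift4[OF _ assms])
  have *: "(\<forall>E. item f E \<notin> set_decode b) \<longleftrightarrow> (\<forall>E. item f E \<in> set_decode b \<longrightarrow> False)" for f b
    by simp
  show "decidable (\<lambda>e. local_ok (e 0) (e 1) (e 2) (e 3))"
    unfolding local_ok_def * bounded_letters bounded_ex_item
    \<comment> \<open>The rule for one quantified stack also matches the innermost quantifier of the
      longer patterns, so it has to come last.\<close>
    unfolding bounded_items(3)
    unfolding bounded_items(2)
    unfolding bounded_items(1)
    by (intro computable_intros)
qed

lemma decidable_reads [computable_intros]:
  assumes "computable F" "computable G" "decidable (\<lambda>e. I (G e) e)"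
    "decidable (\<lambda>e. J (e 0) (e 1))"
  shows "decidable (\<lambda>e. reads (\<lambda>b. I b e) J (F e) (G e))"
proof -
  have *: "(\<exists>b'. p = Suc b' \<and> J b' b) \<longleftrightarrow> (\<exists>b'\<le>p. p = Suc b' \<and> J b' b)" for p b
    by auto
  have "decidable (\<lambda>e. \<exists>b'\<le>e 0. e 0 = Suc b' \<and> J b' (e 1))"
    using decidable_lift2[OF assms(4), of "\<lambda>e. e 0" "\<lambda>e. e (Suc (Suc 0))"]
    by (intro computable_intros) (simp_all add: computable_var)
  then have "decidable (\<lambda>e. \<exists>b'\<le>F e. F e = Suc b' \<and> J b' (G e))"
    using decidable_lift2[of "\<lambda>p b. \<exists>b'\<le>p. p = Suc b' \<and> J b' b"] assms(1,2) by simp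
  moreover have "decidable (\<lambda>e. F e = 0 \<and> I (G e) e)"
    using assms by (intro computable_intros)
  ultimately show ?thesis
    unfolding reads_def * by (rule decidable_disj[rotated])
qed

lemma computable_item_bound [computable_intros]:
  assumes "computable F"
  shows "computable (\<lambda>e. item_bound (F e))"
  by (rule computable_lift1[OF _ assms]) (unfold item_bound_def, intro computable_intros)

lemma computable_label_bound [computable_intros]:
  "computable F \<Longrightarrow> computable (\<lambda>e. label_bound (F e))"
  unfolding label_bound_def by (intro computable_intros)

section \<open>Arithmetical descriptions of the automata and their codes\<close>

lemma list_encode_mono: "list_all2 (\<le>) xs ys \<Longrightarrow> list_encode xs \<le> list_encode ys"
  by (induction rule: list_all2_induct) (auto simp: list_encode.simps intro: prod_encode_mono)

lemma computable_set_encode_atMost [computable_intros]: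
  assumes "computable F"
  shows "computable (\<lambda>e. set_encode {..F e})"
proof -
  have "computable (\<lambda>e. set_encode {z. z \<le> F e \<and> True})"
    by (intro computable_intros assms)
  then show ?thesis by (simp add: atMost_def)
qed

lemma computable_set_encode_last_states [computable_intros]:
  assumes "computable F" "decidable (\<lambda>e. Z (e 0))"
  shows "computable (\<lambda>e. set_encode (last_states (F e) Z))"
  unfolding last_states_def
  by (rule computable_lift1[OF _ assms(1)])
    (intro computable_intros decidable_lift1[where h = Z, OF assms(2)])

text \<open>Replacing every component by its largest value bounds all transition codes at once. The
  set becomes a bounded comprehension, ready for \<open>computable_set_encode\<close>.\<close>

lemma class_aut_transitions_code:
  "(\<lambda>(p, b, q). list_encode [p, b, q]) ` transitions (class_aut W A) =
    {z. z \<le> list_encode [Suc W, W, Suc W] \<and> (\<exists>p\<le>Suc W. \<exists>b\<le>W. z = list_encode [p, b, Suc b] \<and>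
      reads (starts 3 5) (links 1 3 5 6) p b)}"
    (is "?l = ?r")
proof (intro equalityI subsetI)
  fix z assume "z \<in> ?l"
  then obtain p b where z: "p \<le> Suc W" "b \<le> W" "reads (starts 3 5) (links 1 3 5 6) p b"
    "z = list_encode [p, b, Suc b]"
    unfolding class_aut_def by auto
  moreover have "z \<le> list_encode [Suc W, W, Suc W]"
    unfolding z(4) using z(1,2) by (intro list_encode_mono) simp
  ultimately show "z \<in> ?r" by blast
next
  fix z assume "z \<in> ?r"
  then obtain p b where z: "p \<le> Suc W" "b \<le> W" "reads (starts 3 5) (links 1 3 5 6) p b"
    "z = list_encode [p, b, Suc b]"
    by blast
  then have "(p, b, Suc b) \<in> transitions (class_aut W A)"
    by (simp add: class_aut_def)
  then show "z \<in> ?l" unfolding z(4) by (rule rev_image_eqI) simp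
qed

text \<open>The numbering \<open>c\<close> enters only through two constants, the maximum and the
  set code of its finite range. Letters and marks are replaced by numbers, so all quantifiers are
  bounded numerical ones.\<close>

lemma base_aut_transitions_code:
  fixes c :: "'a::finite \<Rightarrow> nat"
  shows "(\<lambda>(p, (a, m, s), b, q). list_encode [p, c a, of_bool m, of_bool s, b, q]) ` t_transitions (base_aut c n W) =
    {z. z \<le> list_encode [Suc W, Max (range c), 1, 1, W, Suc W] \<and>
      (\<exists>p\<le>Suc W. \<exists>l\<le>Max (range c). \<exists>m\<le>1. \<exists>s\<le>1. \<exists>b\<le>W. l \<in> set_decode (set_encode (range c)) \<and>
        z = list_encode [p, l, m, s, b, Suc b] \<and> local_ok l m s b \<and>
        reads (\<lambda>b. starts 2 3 b \<and> item n 0 \<in> set_decode b) (links 0 2 3 4) p b)}"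
    (is "?l = ?r")
proof (intro equalityI subsetI)
  fix z assume "z \<in> ?l"
  then obtain p a m s b where z: "p \<le> Suc W" "b \<le> W" "local_ok (c a) (of_bool m) (of_bool s) b"
    "reads (\<lambda>b. starts 2 3 b \<and> item n 0 \<in> set_decode b) (links 0 2 3 4) p b"
    "z = list_encode [p, c a, of_bool m, of_bool s, b, Suc b]"
    unfolding base_aut_def by auto
  moreover have "c a \<le> Max (range c)" by simp
  moreover have "of_bool m \<le> (1::nat)" "of_bool s \<le> (1::nat)" by simp_all
  moreover have "c a \<in> set_decode (set_encode (range c))" by simp
  moreover have "z \<le> list_encode [Suc W, Max (range c), 1, 1, W, Suc W]"
    unfolding z(5) using z(1,2) by (intro list_encode_mono) simp
  ultimately show "z \<in> ?r" by blast
next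
  fix z assume "z \<in> ?r"
  then obtain p l m s b where z: "p \<le> Suc W" "b \<le> W" "m \<le> 1" "s \<le> 1" "l \<in> set_decode (set_encode (range c))"
    "z = list_encode [p, l, m, s, b, Suc b]" "local_ok l m s b"
    "reads (\<lambda>b. starts 2 3 b \<and> item n 0 \<in> set_decode b) (links 0 2 3 4) p b"
    by blast
  obtain a where a: "l = c a" using z(5) by auto
  obtain m' s' where ms: "m = of_bool m'" "s = of_bool s'"
    \<comment> \<open>A number at most 1 is the truth value of its being 1.\<close>
    using z(3,4) that[of "m = 1" "s = 1"] by (auto simp: le_Suc_eq)
  have "(p, (a, m', s'), b, Suc b) \<in> t_transitions (base_aut c n W)"
    using z(1,2,7,8) unfolding a ms base_aut_def by simp
  then show "z \<in> ?l" unfolding z(6) a ms by (rule rev_image_eqI) simp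
qed

lemma class_aut_sel:
  "states (class_aut W A) = {..Suc W}" "initial (class_aut W A) = {0}" "accepting (class_aut W A) = A"
  by (simp_all add: class_aut_def)

lemma computable_class_aut_code [computable_intros]:
  assumes "computable F" "computable (\<lambda>e. set_encode (A e))"
  shows "computable (\<lambda>e. automaton_code (class_aut (F e) (A e)))"
proof -
  have transitions: "computable (\<lambda>e. set_encode ((\<lambda>(p, b, q). list_encode [p, b, q]) ` transitions (class_aut (F e) (A e))))"
    unfolding class_aut_transitions_code
    by (rule computable_lift1[OF _ assms(1)]) (intro computable_intros)
  show ?thesis
    unfolding automaton_code_def class_aut_sel
    by (intro computable_intros assms transitions)
qed

lemma computable_formula_aut_code:
  fixes c :: "'a::finite \<Rightarrow> nat"
  shows "computable (\<lambda>e. data_omega_automaton_code c (formula_aut c (e 0)))"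
proof -
  have base: "computable (\<lambda>e. transducer_code c (base_aut c (e 0) (label_bound (e 0))))"
    unfolding transducer_code_def base_aut_transitions_code
    unfolding base_aut_def transducer.simps
    by (intro computable_intros)
  show ?thesis
    unfolding data_omega_automaton_code_def formula_aut_def data_automaton.simps data_omega_automaton.simps
    by (intro computable_intros base)
qed

lemma effectively_constructed_formula_aut:
  fixes c :: "'a::finite \<Rightarrow> nat"
  shows "effectively_constructed c \<Phi> (\<lambda>\<phi>. formula_aut c (formula_code c \<phi>))"
  unfolding effectively_constructed_def
  using computable_recursive[OF computable_formula_aut_code] by blast

theorem theorem4:
  fixes c :: "'a::finite \<Rightarrow> nat"
  assumes "infinite (UNIV :: 'd set)" and "inj c"
  shows "\<exists>T :: 'a formula \<Rightarrow> 'a data_omega_automaton.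
    effectively_constructed c {\<phi>. sentence \<phi> \<and> nu_fragment \<phi>} T \<and>
    (\<forall>\<phi>. sentence \<phi> \<and> nu_fragment \<phi> \<longrightarrow>
       wf_data_omega_automaton (T \<phi>) \<and>
       (automaton_omega_language (T \<phi>) :: (nat \<Rightarrow> 'a \<times> 'd) set) = data_omega_language \<phi> \<and>
       (automaton_language (data_automaton.truncate (T \<phi>)) :: ('a \<times> 'd) list set) = data_language \<phi>)"
proof (intro exI conjI allI impI)
  show "effectively_constructed c {\<phi>. sentence \<phi> \<and> nu_fragment \<phi>} (\<lambda>\<phi>. formula_aut c (formula_code c \<phi>))"
    by (rule effectively_constructed_formula_aut)
next
  fix \<phi> :: "'a formula"
  assume "sentence \<phi> \<and> nu_fragment \<phi>"
  then have nu: "nu_fragment \<phi>" by simp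
  show "wf_data_omega_automaton (formula_aut c (formula_code c \<phi>))"
    by (rule wf_formula_aut)
  show "(automaton_omega_language (formula_aut c (formula_code c \<phi>)) :: (nat \<Rightarrow> 'a \<times> 'd) set) = data_omega_language \<phi>"
    using assms(2) nu by (intro automaton_omega_language_formula_aut) simp_all
  show "(automaton_language (data_automaton.truncate (formula_aut c (formula_code c \<phi>))) :: ('a \<times> 'd) list set) =
      data_language \<phi>"
    using assms(2) nu by (intro automaton_language_formula_aut) simp_all
qed

end
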